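(* Let $(W,I)$ be of type $E_8$, and let $J_1,J_2$ be proper subsets of $I=\{1,\dots,8\}$. Then $$J_1\star_I J_2=\begin{cases}\{2,3,4,5\}, & \text{if } J_1=J_2=I-\{8\};\\ \emptyset, & \text{otherwise.}\end{cases}$$
   Context: $(W,I)$ is a finite Coxeter group with simple reflections $s_i$ ($i\in I$). The monoid operation $\ast$ on $W$ is determined by $T'_xT'_y=T'_{x\ast y}$ in the $0$-Hecke algebra, where $T'_{s_i}$ satisfy $T'^2_{s_i}=T'_{s_i}$ and the braid relations, and $T'_w=T'_{s_{i_1}}\cdots T'_{s_{i_k}}$ for any reduced expression $w=s_{i_1}\cdots s_{i_k}$; equivalently $s_i\ast w$ is the Bruhat-larger of $w$ and $s_iw$. For $J\subset I$, $w_0^J$ is the longest element of $W_J=\langle s_j: j\in J\rangle$. For $J_1,J_2\subset I$, $J_1\star_I J_2$ is the unique subset $K\subset I$ with $(w_0^{J_1}w_0^I)\ast(w_0^{J_2}w_0^I)=w_0^{K}w_0^I$ (such a $K$ always exists). Type $E_8$: Bourbaki labeling, simple edges $1-3-4-5-6-7-8$ and $2-4$. *)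

theory Defs
  imports "HOL-Algebra.QuotRing" "HOL-Algebra.Generated_Groups"
begin

section \<open>Coxeter groups\<close>

text \<open>
  A Coxeter matrix is a function \<open>m\<close> on pairs of elements of \<open>I\<close>.  The value \<open>0\<close> encodes
  infinity: the relations below are then void.
\<close>

definition coxeter_matrix :: "'i set \<Rightarrow> ('i \<Rightarrow> 'i \<Rightarrow> nat) \<Rightarrow> bool" where
  "coxeter_matrix I m \<longleftrightarrow>
     (\<forall>i\<in>I. m i i = 1) \<and> (\<forall>i\<in>I. \<forall>j\<in>I. m i j = m j i \<and> (i \<noteq> j \<longrightarrow> m i j \<noteq> 1))"

text \<open>
  The congruence on words presenting the Coxeter group, with relators \<open>(i j)^(m i j)\<close>.  Since
  \<open>m i i = 1\<close>, the word \<open>i i\<close> is a relator, so each generator is its own inverse and the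
  presentation as a monoid is also the presentation as a group.
\<close>

inductive coxeter_equiv :: "'i set \<Rightarrow> ('i \<Rightarrow> 'i \<Rightarrow> nat) \<Rightarrow> 'i list \<Rightarrow> 'i list \<Rightarrow> bool"
  for I m where
  equiv_relator: "i \<in> I \<Longrightarrow> j \<in> I \<Longrightarrow> coxeter_equiv I m (concat (replicate (m i j) [i, j])) []"
| equiv_refl: "u \<in> lists I \<Longrightarrow> coxeter_equiv I m u u"
| equiv_sym: "coxeter_equiv I m u v \<Longrightarrow> coxeter_equiv I m v u"
| equiv_trans: "coxeter_equiv I m u v \<Longrightarrow> coxeter_equiv I m v w \<Longrightarrow> coxeter_equiv I m u w"
| equiv_append: "coxeter_equiv I m u u' \<Longrightarrow> coxeter_equiv I m v v' \<Longrightarrow> coxeter_equiv I m (u @ v) (u' @ v')"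

definition word_prod :: "('a, 'b) monoid_scheme \<Rightarrow> ('i \<Rightarrow> 'a) \<Rightarrow> 'i list \<Rightarrow> 'a" where
  "word_prod G s u = foldr (\<lambda>i x. s i \<otimes>\<^bsub>G\<^esub> x) u \<one>\<^bsub>G\<^esub>"

text \<open>
  The group \<open>G\<close> together with the family \<open>s\<close> of simple reflections indexed by \<open>I\<close> is a Coxeter
  group with Coxeter matrix \<open>m\<close>: it is generated by the \<open>s i\<close>, and two words have the same
  value exactly if the defining relations identify them.
\<close>

definition coxeter_group ::
    "('a, 'b) monoid_scheme \<Rightarrow> 'i set \<Rightarrow> ('i \<Rightarrow> 'a) \<Rightarrow> ('i \<Rightarrow> 'i \<Rightarrow> nat) \<Rightarrow> bool" where
  "coxeter_group G I s m \<longleftrightarrow>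
     group G \<and> finite I \<and> coxeter_matrix I m \<and> s \<in> I \<rightarrow> carrier G \<and>
     generate G (s ` I) = carrier G \<and>
     (\<forall>u\<in>lists I. \<forall>v\<in>lists I. word_prod G s u = word_prod G s v \<longleftrightarrow> coxeter_equiv I m u v)"

definition finite_coxeter_group ::
    "('a, 'b) monoid_scheme \<Rightarrow> 'i set \<Rightarrow> ('i \<Rightarrow> 'a) \<Rightarrow> ('i \<Rightarrow> 'i \<Rightarrow> nat) \<Rightarrow> bool" where
  "finite_coxeter_group G I s m \<longleftrightarrow> coxeter_group G I s m \<and> finite (carrier G)"

definition cox_length :: "('a, 'b) monoid_scheme \<Rightarrow> 'i set \<Rightarrow> ('i \<Rightarrow> 'a) \<Rightarrow> 'a \<Rightarrow> nat" where
  "cox_length G I s w = (LEAST n. \<exists>u\<in>lists I. length u = n \<and> word_prod G s u = w)"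

definition reduced_expression ::
    "('a, 'b) monoid_scheme \<Rightarrow> 'i set \<Rightarrow> ('i \<Rightarrow> 'a) \<Rightarrow> 'i list \<Rightarrow> 'a \<Rightarrow> bool" where
  "reduced_expression G I s u w \<longleftrightarrow>
     u \<in> lists I \<and> word_prod G s u = w \<and> length u = cox_length G I s w"

text \<open>The longest element of the parabolic subgroup generated by \<open>s j\<close>, \<open>j \<in> J\<close>.\<close>

definition longest_elt :: "('a, 'b) monoid_scheme \<Rightarrow> 'i set \<Rightarrow> ('i \<Rightarrow> 'a) \<Rightarrow> 'i set \<Rightarrow> 'a" where
  "longest_elt G I s J = (ARG_MAX (cox_length G I s) w. w \<in> generate G (s ` J))"


section \<open>The 0-Hecke algebra\<close>

text \<open>
  The free associative unital algebra over a commutative ring \<open>'k\<close> on generators \<open>I\<close>: finitely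
  supported functions on words, with multiplication extending concatenation bilinearly.
\<close>

definition free_algebra :: "'i set \<Rightarrow> ('i list \<Rightarrow> 'k::comm_ring_1) ring" where
  "free_algebra I =
     \<lparr>carrier = {f. finite {w. f w \<noteq> 0} \<and> {w. f w \<noteq> 0} \<subseteq> lists I},
      mult = (\<lambda>f g w. \<Sum>k\<le>length w. f (take k w) * g (drop k w)),
      one = (\<lambda>w. if w = [] then 1 else 0),
      zero = (\<lambda>w. 0),
      add = (\<lambda>f g w. f w + g w)\<rparr>"

definition word_elt :: "'i list \<Rightarrow> 'i list \<Rightarrow> 'k::comm_ring_1" where
  "word_elt u = (\<lambda>w. if w = u then 1 else 0)"

text \<open>\<open>alternating i j n\<close> is the word \<open>i j i j ...\<close> of length \<open>n\<close>.\<close>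

fun alternating :: "'i \<Rightarrow> 'i \<Rightarrow> nat \<Rightarrow> 'i list" where
  "alternating i j 0 = []"
| "alternating i j (Suc n) = i # alternating j i n"

definition hecke0_relators :: "'i set \<Rightarrow> ('i \<Rightarrow> 'i \<Rightarrow> nat) \<Rightarrow> ('i list \<Rightarrow> 'k::comm_ring_1) set" where
  "hecke0_relators I m =
     {\<lambda>w. word_elt [i, i] w - word_elt [i] w | i. i \<in> I} \<union>
     {\<lambda>w. word_elt (alternating i j (m i j)) w - word_elt (alternating j i (m i j)) w
        | i j. i \<in> I \<and> j \<in> I}"

text \<open>
  Two-sided ring ideals of \<open>free_algebra I\<close> are stable under scalars, because the scalars are the
  multiples of the empty word.
\<close>

definition hecke0_ideal :: "'i set \<Rightarrow> ('i \<Rightarrow> 'i \<Rightarrow> nat) \<Rightarrow> ('i list \<Rightarrow> 'k::comm_ring_1) set" where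
  "hecke0_ideal I m = Idl\<^bsub>free_algebra I\<^esub> (hecke0_relators I m)"

definition hecke0_algebra ::
    "'i set \<Rightarrow> ('i \<Rightarrow> 'i \<Rightarrow> nat) \<Rightarrow> (('i list \<Rightarrow> 'k::comm_ring_1) set) ring" where
  "hecke0_algebra I m = free_algebra I Quot hecke0_ideal I m"

definition hecke0_gen ::
    "'i set \<Rightarrow> ('i \<Rightarrow> 'i \<Rightarrow> nat) \<Rightarrow> 'i \<Rightarrow> ('i list \<Rightarrow> 'k::comm_ring_1) set" where
  "hecke0_gen I m i = hecke0_ideal I m +>\<^bsub>free_algebra I\<^esub> word_elt [i]"

text \<open>By Matsumoto's theorem the next definition does not depend on the reduced expression.\<close>

definition hecke0_T ::
    "('a, 'b) monoid_scheme \<Rightarrow> 'i set \<Rightarrow> ('i \<Rightarrow> 'a) \<Rightarrow> ('i \<Rightarrow> 'i \<Rightarrow> nat) \<Rightarrow> 'a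
      \<Rightarrow> ('i list \<Rightarrow> 'k::comm_ring_1) set" where
  "hecke0_T G I s m w =
     word_prod (hecke0_algebra I m) (hecke0_gen I m) (SOME u. reduced_expression G I s u w)"

text \<open>The first argument of the next two operations only fixes the ground ring \<open>'k\<close>.\<close>

definition hecke0_star ::
    "'k::comm_ring_1 itself \<Rightarrow> ('a, 'b) monoid_scheme \<Rightarrow> 'i set \<Rightarrow> ('i \<Rightarrow> 'a)
      \<Rightarrow> ('i \<Rightarrow> 'i \<Rightarrow> nat) \<Rightarrow> 'a \<Rightarrow> 'a \<Rightarrow> 'a" where
  "hecke0_star _ G I s m x y =
     (THE z. z \<in> carrier G \<and>
        (hecke0_T G I s m x :: ('i list \<Rightarrow> 'k) set)
          \<otimes>\<^bsub>hecke0_algebra I m\<^esub> hecke0_T G I s m y = hecke0_T G I s m z)"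

definition subset_star ::
    "'k::comm_ring_1 itself \<Rightarrow> ('a, 'b) monoid_scheme \<Rightarrow> 'i set \<Rightarrow> ('i \<Rightarrow> 'a)
      \<Rightarrow> ('i \<Rightarrow> 'i \<Rightarrow> nat) \<Rightarrow> 'i set \<Rightarrow> 'i set \<Rightarrow> 'i set" where
  "subset_star k G I s m J\<^sub>1 J\<^sub>2 =
     (THE K. K \<subseteq> I \<and>
        hecke0_star k G I s m
          (longest_elt G I s J\<^sub>1 \<otimes>\<^bsub>G\<^esub> longest_elt G I s I)
          (longest_elt G I s J\<^sub>2 \<otimes>\<^bsub>G\<^esub> longest_elt G I s I)
        = longest_elt G I s K \<otimes>\<^bsub>G\<^esub> longest_elt G I s I)"


section \<open>Type \<open>E\<^sub>8\<close>, Bourbaki labeling\<close>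

definition E8_edges :: "nat set set" where
  "E8_edges = {{1,3}, {3,4}, {4,5}, {5,6}, {6,7}, {7,8}, {2,4}}"

definition E8_matrix :: "nat \<Rightarrow> nat \<Rightarrow> nat" where
  "E8_matrix i j = (if i = j then 1 else if {i, j} \<in> E8_edges then 3 else 2)"

end

theory Submission
  imports Defs
begin

text \<open>
  Write \<open>w0\<close> for the longest element and \<open>x J\<close> for the longest element of the parabolic subgroup
  of \<open>J\<close>, multiplied by \<open>w0\<close>.  Since \<open>x {} = w0\<close>, the claim is that \<open>x J1 * x J2 = w0\<close> in the 0-Hecke
  monoid for all proper subsets but one pair.

  An element \<open>w\<close> is encoded by the weight \<open>w rho\<close>, where \<open>rho\<close> has all coordinates \<open>1\<close> in the basis
  of fundamental weights.  The sign of the \<open>i\<close>-th coordinate of \<open>w rho\<close> tells whether \<open>s i w\<close> is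
  longer or shorter than \<open>w\<close> (\<open>ascent_positive\<close>), so multiplication by \<open>s i\<close> in the 0-Hecke monoid
  becomes the Demazure step "reflect if the \<open>i\<close>-th coordinate is positive".  These steps satisfy the
  idempotent and braid relations on all weights.  Conversely, by Matsumoto's theorem
  (\<open>matsumoto\<close>), two words that move \<open>rho\<close> to the same weight are related by these relations, and
  the 0-Hecke algebra imposes no further identities between words (\<open>hecke_word_eq_iff\<close>).  Hence
  products in the 0-Hecke algebra can be computed on weights (\<open>hecke0_star_eq\<close>).  The longest
  element of a parabolic subgroup is its only element which makes all coordinates in \<open>J\<close> of \<open>rho\<close>
  negative (\<open>longest_unique\<close>).

  It suffices to treat maximal proper subsets.  If \<open>K \<subseteq> J\<close>, then \<open>x K = q * x J\<close> for some \<open>q\<close>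
  (\<open>coset_elt_extend\<close>).  In type \<open>E\<^sub>8\<close> the element \<open>w0\<close> acts as \<open>-1\<close>, hence is central, so the elements
  \<open>x J\<close> are involutions and, reversing words, also \<open>x K = x J * q'\<close> for some \<open>q'\<close>.  As \<open>w0\<close> absorbs every
  factor, \<open>x J1 * x J2 = w0\<close> passes to all smaller subsets (\<open>product_longest_mono\<close>).  A pair of
  proper subsets other than \<open>I - {8}\<close> twice lies below a pair of maximal subsets other than that
  one.  The remaining 63 products of maximal pairs are computed on explicit weights
  (\<open>e8_star_negative\<close>), and the exceptional product yields the weight of \<open>x {2, 3, 4, 5}\<close>
  (\<open>e8_D4_rounds\<close>).
\<close>

section \<open>Weights\<close>

definition cartan :: "('i \<Rightarrow> 'i \<Rightarrow> nat) \<Rightarrow> 'i \<Rightarrow> 'i \<Rightarrow> int" where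
  "cartan m i j = (if i = j then 2 else if m i j = 3 then - 1 else 0)"

text \<open>
  A weight is given by its coordinates in the basis of fundamental weights; \<open>reflect m i\<close> subtracts
  \<open>v i\<close> times the \<open>i\<close>-th simple root.
\<close>

definition reflect :: "('i \<Rightarrow> 'i \<Rightarrow> nat) \<Rightarrow> 'i \<Rightarrow> ('i \<Rightarrow> int) \<Rightarrow> 'i \<Rightarrow> int" where
  "reflect m i v = (\<lambda>k. v k - cartan m i k * v i)"

definition dem :: "('i \<Rightarrow> 'i \<Rightarrow> nat) \<Rightarrow> 'i \<Rightarrow> ('i \<Rightarrow> int) \<Rightarrow> 'i \<Rightarrow> int" where
  "dem m i v = (if v i > 0 then reflect m i v else v)"

definition rho :: "'i set \<Rightarrow> 'i \<Rightarrow> int" where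
  "rho I = (\<lambda>i. if i \<in> I then 1 else 0)"

section \<open>The 0-Hecke congruence on words\<close>

text \<open>
  The congruence classes of words form the 0-Hecke monoid; the relations are the relators of the 0-Hecke
  algebra.
\<close>

inductive hecke_equiv :: "'i set \<Rightarrow> ('i \<Rightarrow> 'i \<Rightarrow> nat) \<Rightarrow> 'i list \<Rightarrow> 'i list \<Rightarrow> bool"
  for I m where
  hecke_idem: "i \<in> I \<Longrightarrow> hecke_equiv I m [i, i] [i]"
| hecke_braid: "i \<in> I \<Longrightarrow> j \<in> I \<Longrightarrow>
    hecke_equiv I m (alternating i j (m i j)) (alternating j i (m i j))"
| hecke_refl: "u \<in> lists I \<Longrightarrow> hecke_equiv I m u u"
| hecke_sym: "hecke_equiv I m u v \<Longrightarrow> hecke_equiv I m v u"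
| hecke_trans: "hecke_equiv I m u v \<Longrightarrow> hecke_equiv I m v w \<Longrightarrow> hecke_equiv I m u w"
| hecke_append: "hecke_equiv I m u u' \<Longrightarrow> hecke_equiv I m v v' \<Longrightarrow> hecke_equiv I m (u @ v) (u' @ v')"

lemma alternating_in_lists: "i \<in> I \<Longrightarrow> j \<in> I \<Longrightarrow> alternating i j n \<in> lists I"
  by (induction i j n rule: alternating.induct) auto

lemma hecke_equiv_lists: "hecke_equiv I m u v \<Longrightarrow> u \<in> lists I \<and> v \<in> lists I"
  by (induction rule: hecke_equiv.induct) (auto simp: alternating_in_lists simp del: in_lists_conv_set)

lemma hecke_Cons: "i \<in> I \<Longrightarrow> hecke_equiv I m u v \<Longrightarrow> hecke_equiv I m (i # u) (i # v)"
  using hecke_append[OF hecke_refl[of "[i]" I m], of u v] by simp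

lemma rev_alternating:
  "rev (alternating i j n) = (if even n then alternating j i n else alternating i j n)"
proof -
  have snoc: "alternating i j (Suc n) = alternating i j n @ [if even n then i else j]" for i j :: 'a and n
  proof (induction n arbitrary: i j)
    case (Suc n)
    show ?case using Suc.IH[of j i] by simp
  qed simp
  show ?thesis
  proof (induction n arbitrary: i j)
    case (Suc n)
    show ?case
      by (subst snoc) (simp add: Suc.IH)
  qed simp
qed

lemma hecke_rev: "hecke_equiv I m u v \<Longrightarrow> hecke_equiv I m (rev u) (rev v)"
proof (induction rule: hecke_equiv.induct)
  case (hecke_braid i j)
  then show ?case
    by (auto simp: rev_alternating intro: hecke_equiv.hecke_braid hecke_equiv.hecke_sym)
qed (auto intro: hecke_equiv.intros)

section \<open>Reflections and Demazure steps on weights\<close>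

lemma reflect_uminus: "reflect m i (\<lambda>k. - v k) = (\<lambda>k. - reflect m i v k)"
  by (auto simp: reflect_def)

lemma act_uminus: "foldr (reflect m) u (\<lambda>k. - v k) = (\<lambda>k. - foldr (reflect m) u v k)"
  by (induction u) (auto simp: reflect_uminus)

lemma reflect_self: "reflect m i v i = - v i"
  by (simp add: reflect_def cartan_def)

lemma reflect_reflect: "reflect m i (reflect m i v) = v"
  by (auto simp: reflect_def cartan_def)

lemma reflect_commute:
  assumes "cartan m i j = 0" "cartan m j i = 0"
  shows "reflect m i (reflect m j v) = reflect m j (reflect m i v)"
  using assms by (auto simp: reflect_def algebra_simps)

lemma reflect_braid:
  assumes "cartan m i j = -1" "cartan m j i = -1"
  shows "reflect m i (reflect m j (reflect m i v)) = reflect m j (reflect m i (reflect m j v))"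
proof
  fix k
  have ii: "cartan m i i = 2" "cartan m j j = 2" by (auto simp: cartan_def)
  show "reflect m i (reflect m j (reflect m i v)) k = reflect m j (reflect m i (reflect m j v)) k"
    by (simp add: reflect_def assms ii algebra_simps)
qed

lemma lists_subset: "u \<in> lists J \<Longrightarrow> J \<subseteq> I \<Longrightarrow> u \<in> lists I"
  by auto

lemma dem_pos: "v i > 0 \<Longrightarrow> dem m i v = reflect m i v"
  and dem_nonpos: "v i \<le> 0 \<Longrightarrow> dem m i v = v"
  by (auto simp: dem_def)

lemma dem_idem: "dem m i (dem m i v) = dem m i v"
  by (simp add: dem_def reflect_self)

lemma dem_commute:
  assumes "cartan m i j = 0" "cartan m j i = 0"
  shows "dem m i (dem m j v) = dem m j (dem m i v)"
  using assms reflect_commute[OF assms] by (auto simp: dem_def) (auto simp: reflect_def)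

text \<open>
  Both sides are computed in the plane of the \<open>i\<close>-th and \<open>j\<close>-th coordinates, which the two reflections
  map to \<open>(- a, a + b)\<close> and \<open>(a + b, - b)\<close>.  Whatever the signs are, both sides end at the weight with
  nonpositive coordinates \<open>i\<close> and \<open>j\<close> in the orbit of \<open>v\<close> under the two reflections.
\<close>

lemma dem_braid:
  assumes "cartan m i j = -1" "cartan m j i = -1"
  shows "dem m i (dem m j (dem m i v)) = dem m j (dem m i (dem m j v))"
proof -
  have ii: "cartan m i i = 2" "cartan m j j = 2" by (auto simp: cartan_def)
  have c: "reflect m i w i = - w i" "reflect m j w j = - w j" "reflect m i w j = w i + w j"
     "reflect m j w i = w i + w j" for w
    by (auto simp: reflect_def assms ii)
  show ?thesis
    unfolding dem_def by (auto simp: c reflect_braid[OF assms])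
qed

section \<open>Simply laced Coxeter groups acting on weights\<close>

locale simply_laced =
  fixes G :: "('a, 'b) monoid_scheme" (structure)
    and I :: "'i set" and s :: "'i \<Rightarrow> 'a" and m :: "'i \<Rightarrow> 'i \<Rightarrow> nat"
  assumes coxeter: "coxeter_group G I s m"
    and laced: "i \<in> I \<Longrightarrow> j \<in> I \<Longrightarrow> i \<noteq> j \<Longrightarrow> m i j = 2 \<or> m i j = 3"
begin

sublocale group G
  using coxeter by (simp add: coxeter_group_def)

abbreviation wp :: "'i list \<Rightarrow> 'a" where "wp \<equiv> word_prod G s"

lemma s_closed [simp]: "i \<in> I \<Longrightarrow> s i \<in> carrier G"
  using coxeter by (auto simp: coxeter_group_def)

lemma m_diag: "i \<in> I \<Longrightarrow> m i i = 1"
  and m_sym: "i \<in> I \<Longrightarrow> j \<in> I \<Longrightarrow> m i j = m j i"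
  using coxeter by (auto simp: coxeter_group_def coxeter_matrix_def)

lemma wp_eq_iff: "u \<in> lists I \<Longrightarrow> v \<in> lists I \<Longrightarrow> wp u = wp v \<longleftrightarrow> coxeter_equiv I m u v"
  using coxeter by (simp add: coxeter_group_def)

lemma wp_Nil [simp]: "wp [] = \<one>" and wp_Cons [simp]: "wp (i # u) = s i \<otimes> wp u"
  by (simp_all add: word_prod_def)

lemma wp_closed [simp]: "u \<in> lists I \<Longrightarrow> wp u \<in> carrier G"
  by (induction u) auto

lemma wp_append: "u \<in> lists I \<Longrightarrow> v \<in> lists I \<Longrightarrow> wp (u @ v) = wp u \<otimes> wp v"
  by (induction u) (auto simp: m_assoc simp flip: in_lists_conv_set)

lemma relator_eq_one:
  assumes "i \<in> I" "j \<in> I"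
  shows "wp (concat (replicate (m i j) [i, j])) = \<one>"
proof -
  have "set (concat (replicate (m i j) [i, j])) \<subseteq> I" using assms by auto
  then have "concat (replicate (m i j) [i, j]) \<in> lists I" by auto
  then have "wp (concat (replicate (m i j) [i, j])) = wp []"
    using equiv_relator[OF assms, of m] by (subst wp_eq_iff) auto
  then show ?thesis by simp
qed

lemma s_square [simp]: "i \<in> I \<Longrightarrow> s i \<otimes> s i = \<one>"
  using relator_eq_one[of i i] by (simp add: m_diag)

lemma s_cancel [simp]: "i \<in> I \<Longrightarrow> x \<in> carrier G \<Longrightarrow> s i \<otimes> (s i \<otimes> x) = x"
  by (simp flip: m_assoc)

lemma s_inv: "i \<in> I \<Longrightarrow> inv (s i) = s i"
  by (simp add: inv_equality)

lemma s_commute: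
  assumes "i \<in> I" "j \<in> I" "m i j = 2"
  shows "s i \<otimes> s j = s j \<otimes> s i"
proof -
  have "(s i \<otimes> s j) \<otimes> (s i \<otimes> s j) = \<one>"
    using relator_eq_one[of i j] assms by (simp add: numeral_2_eq_2 m_assoc)
  then have "s i \<otimes> s j = inv (s i \<otimes> s j)"
    using assms by (metis inv_equality m_closed s_closed)
  then show ?thesis using assms by (simp add: inv_mult_group s_inv)
qed

lemma s_braid:
  assumes "i \<in> I" "j \<in> I" "m i j = 3"
  shows "s i \<otimes> (s j \<otimes> s i) = s j \<otimes> (s i \<otimes> s j)"
proof -
  have "(s i \<otimes> (s j \<otimes> s i)) \<otimes> (s j \<otimes> (s i \<otimes> s j)) = \<one>"
    using relator_eq_one[of i j] assms by (simp add: numeral_3_eq_3 m_assoc)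
  then have "s i \<otimes> (s j \<otimes> s i) = inv (s j \<otimes> (s i \<otimes> s j))"
    using assms by (metis inv_equality m_closed s_closed)
  then show ?thesis using assms by (simp add: inv_mult_group s_inv m_assoc)
qed

lemma s_commute': "i \<in> I \<Longrightarrow> j \<in> I \<Longrightarrow> m i j = 2 \<Longrightarrow> x \<in> carrier G \<Longrightarrow>
    s i \<otimes> (s j \<otimes> x) = s j \<otimes> (s i \<otimes> x)"
  using s_commute[of i j] by (simp flip: m_assoc)

lemma s_braid': "i \<in> I \<Longrightarrow> j \<in> I \<Longrightarrow> m i j = 3 \<Longrightarrow> x \<in> carrier G \<Longrightarrow>
    s i \<otimes> (s j \<otimes> (s i \<otimes> x)) = s j \<otimes> (s i \<otimes> (s j \<otimes> x))"
  using arg_cong[OF s_braid[of i j], of "\<lambda>y. y \<otimes> x"] by (simp add: m_assoc)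

lemma cartan_commute: "i \<in> I \<Longrightarrow> j \<in> I \<Longrightarrow> m i j = 2 \<Longrightarrow> cartan m i j = 0 \<and> cartan m j i = 0"
  using m_sym[of i j] m_diag[of i] by (auto simp: cartan_def)

lemma cartan_braid: "i \<in> I \<Longrightarrow> j \<in> I \<Longrightarrow> m i j = 3 \<Longrightarrow> cartan m i j = -1 \<and> cartan m j i = -1"
  using m_sym[of i j] m_diag[of i] by (auto simp: cartan_def)

lemma act_respects: "coxeter_equiv I m u v \<Longrightarrow> foldr (reflect m) u = foldr (reflect m) v"
proof (induction rule: coxeter_equiv.induct)
  case (equiv_relator i j)
  consider "i = j" | "i \<noteq> j" "m i j = 2" | "i \<noteq> j" "m i j = 3" using laced equiv_relator by blast
  then show ?case
  proof cases
    case 1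
    then show ?thesis using equiv_relator by (auto simp: m_diag reflect_reflect)
  next
    case 2
    then have c: "cartan m i j = 0" "cartan m j i = 0" using equiv_relator cartan_commute by auto
    show ?thesis using 2
      by (auto simp: numeral_2_eq_2 reflect_commute[OF c] reflect_reflect)
  next
    case 3
    then have c: "cartan m i j = -1" "cartan m j i = -1" using equiv_relator cartan_braid by auto
    show ?thesis using 3
      by (auto simp: numeral_3_eq_3 reflect_braid[OF c] reflect_reflect)
  qed
qed auto

text \<open>
  All relators have even length.  This is the sign character, by which multiplication by a simple
  reflection always changes the length.
\<close>

lemma parity_respects: "coxeter_equiv I m u v \<Longrightarrow> even (length u) = even (length v)"
  by (induction rule: coxeter_equiv.induct) (auto simp: length_concat sum_list_replicate)

lemma dem_respects: "hecke_equiv I m u v \<Longrightarrow> foldr (dem m) u = foldr (dem m) v"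
proof (induction rule: hecke_equiv.induct)
  case (hecke_braid i j)
  consider "i = j" | "i \<noteq> j" "m i j = 2" | "i \<noteq> j" "m i j = 3" using laced hecke_braid by blast
  then show ?case
  proof cases
    case 2
    then have c: "cartan m i j = 0" "cartan m j i = 0" using hecke_braid cartan_commute by auto
    show ?thesis using 2
      by (auto simp: numeral_2_eq_2 dem_commute[OF c])
  next
    case 3
    then have c: "cartan m i j = -1" "cartan m j i = -1" using hecke_braid cartan_braid by auto
    show ?thesis using 3
      by (auto simp: numeral_3_eq_3 dem_braid[OF c])
  qed simp
qed (auto simp: dem_idem)

lemma generate_eq_wp: 
  assumes J: "J \<subseteq> I" 
  shows "generate G (s ` J) = wp ` lists J"
proof
  show "generate G (s ` J) \<subseteq> wp ` lists J"
  proof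
    fix x assume "x \<in> generate G (s ` J)"
    then show "x \<in> wp ` lists J"
    proof (induction rule: generate.induct)
      case one
      show ?case by (rule image_eqI[of _ _ "[]"]) auto
    next
      case (incl h)
      then obtain j where "j \<in> J" "h = s j" by auto
      then show ?case using J by (intro image_eqI[of _ _ "[j]"]) auto
    next
      case (inv h)
      then obtain j where "j \<in> J" "h = s j" by auto
      then show ?case using J by (intro image_eqI[of _ _ "[j]"]) (auto simp: s_inv subset_iff)
    next
      case (eng h1 h2)
      then obtain u v where uv: "u \<in> lists J" "h1 = wp u" "v \<in> lists J" "h2 = wp v" by auto
      then have "u \<in> lists I" "v \<in> lists I" using J lists_mono by blast+
      then show ?case using uv
        by (intro image_eqI[of _ _ "u @ v"]) (auto simp: wp_append)
    qed
  qed
  show "wp ` lists J \<subseteq> generate G (s ` J)"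
  proof
    fix x assume "x \<in> wp ` lists J"
    then obtain u where "u \<in> lists J" "x = wp u" by auto
    then show "x \<in> generate G (s ` J)"
      by (induction u arbitrary: x) (auto intro: generate.intros)
  qed
qed

lemma carrier_eq_wp: "carrier G = wp ` lists I"
  using generate_eq_wp[of I] coxeter by (simp add: coxeter_group_def)

text \<open>
  By \<open>act_respects\<close> the choice of the word does not matter.
\<close>

definition gact :: "'a \<Rightarrow> ('i \<Rightarrow> int) \<Rightarrow> 'i \<Rightarrow> int" where
  "gact g = foldr (reflect m) (SOME u. u \<in> lists I \<and> wp u = g)"

lemma gact_wp: 
  assumes "u \<in> lists I" 
  shows "gact (wp u) = foldr (reflect m) u"
proof -
  define v where "v = (SOME v. v \<in> lists I \<and> wp v = wp u)"
  have "v \<in> lists I \<and> wp v = wp u" unfolding v_def by (rule someI) (use assms in auto)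
  then have "foldr (reflect m) v = foldr (reflect m) u" using act_respects wp_eq_iff assms by blast
  then show ?thesis by (simp add: gact_def v_def)
qed

lemma gact_one [simp]: "gact \<one> v = v"
  using gact_wp[of "[]"] by simp

lemma gact_mult: 
  assumes "g \<in> carrier G" "h \<in> carrier G" 
  shows "gact (g \<otimes> h) v = gact g (gact h v)"
proof -
  obtain a b where "a \<in> lists I" "g = wp a" "b \<in> lists I" "h = wp b"
    using assms carrier_eq_wp by auto
  then show ?thesis using gact_wp[of "a @ b"] by (simp add: wp_append gact_wp)
qed

lemma gact_s: "i \<in> I \<Longrightarrow> gact (s i) = reflect m i"
  using gact_wp[of "[i]"] by (auto simp: fun_eq_iff)

lemma gact_s_mult: "i \<in> I \<Longrightarrow> g \<in> carrier G \<Longrightarrow> gact (s i \<otimes> g) v = reflect m i (gact g v)"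
  by (simp add: gact_mult gact_s)

lemma gact_uminus: "gact g (\<lambda>k. - v k) = (\<lambda>k. - gact g v k)"
  by (simp add: gact_def act_uminus)

section \<open>Length and signs of coordinates\<close>

abbreviation len :: "'i set \<Rightarrow> 'a \<Rightarrow> nat" where "len J \<equiv> cox_length G J s"

lemma len_le: "u \<in> lists J \<Longrightarrow> len J (wp u) \<le> length u"
  unfolding cox_length_def by (rule Least_le) auto

lemma len_word:
  assumes "w \<in> wp ` lists J"
  obtains u where "u \<in> lists J" "wp u = w" "length u = len J w"
proof -
  have "\<exists>n. \<exists>u\<in>lists J. length u = n \<and> wp u = w" using assms by auto
  then have "\<exists>u\<in>lists J. length u = len J w \<and> wp u = w"
    unfolding cox_length_def by (rule LeastI_ex)
  then show ?thesis using that by auto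
qed

lemma mult_in_parabolic: "j \<in> J \<Longrightarrow> w \<in> wp ` lists J \<Longrightarrow> s j \<otimes> w \<in> wp ` lists J"
  by (auto intro!: image_eqI[of _ _ "j # _"])

lemma len_mult_le:
  assumes "j \<in> J" "w \<in> wp ` lists J"
  shows "len J (s j \<otimes> w) \<le> Suc (len J w)"
proof -
  obtain u where "u \<in> lists J" "wp u = w" "length u = len J w" using len_word assms by metis
  then show ?thesis using len_le[of "j # u" J] assms by auto
qed

lemma len_mult_neq:
  assumes "J \<subseteq> I" "j \<in> J" "w \<in> wp ` lists J"
  shows "len J (s j \<otimes> w) \<noteq> len J w"
proof
  assume eq: "len J (s j \<otimes> w) = len J w"
  obtain u where u: "u \<in> lists J" "wp u = w" "length u = len J w" using len_word assms by metis
  obtain v where v: "v \<in> lists J" "wp v = s j \<otimes> w" "length v = len J (s j \<otimes> w)"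
    using len_word mult_in_parabolic assms by metis
  have I: "j # u \<in> lists I" "v \<in> lists I" using u v assms by auto
  have "wp v = wp (j # u)" using u v by simp
  then have "even (length v) = even (length (j # u))" using I wp_eq_iff parity_respects by blast
  then show False using u v eq by simp
qed

lemma len_cases:
  assumes "J \<subseteq> I" "j \<in> J" "w \<in> wp ` lists J"
  shows "len J (s j \<otimes> w) = Suc (len J w) \<or> len J w = Suc (len J (s j \<otimes> w))"
proof -
  have "w \<in> carrier G" using assms carrier_eq_wp lists_mono by blast
  then have "s j \<otimes> (s j \<otimes> w) = w" using assms by auto
  then have "len J w \<le> Suc (len J (s j \<otimes> w))"
    using len_mult_le[OF assms(2) mult_in_parabolic[OF assms(2,3)]] by simp
  then show ?thesis using len_mult_le[OF assms(2,3)] len_mult_neq[OF assms] by linarith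
qed

lemma parabolic_closed: "J \<subseteq> I \<Longrightarrow> w \<in> wp ` lists J \<Longrightarrow> w \<in> carrier G"
  using carrier_eq_wp lists_mono by blast

lemma left_descent_exists:
  assumes "J \<subseteq> I" "w \<in> wp ` lists J" "w \<noteq> \<one>"
  obtains j where "j \<in> J" "len J w = Suc (len J (s j \<otimes> w))"
proof -
  obtain u where u: "u \<in> lists J" "wp u = w" "length u = len J w" using len_word assms by metis
  then obtain j t where t: "u = j # t" using assms by (cases u) auto
  have j: "j \<in> J" "t \<in> lists J" using u t by auto
  have "wp t \<in> carrier G" using parabolic_closed[OF assms(1)] j(2) by blast
  then have "s j \<otimes> wp u = wp t" using t j(1) assms(1) by (simp add: subset_iff)
  then have "s j \<otimes> w = wp t" by (simp add: u(2))
  then have "len J (s j \<otimes> w) < len J w" using len_le[of t J] j u t by simp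
  then show ?thesis using that[OF j(1)] len_cases[OF assms(1) j(1) assms(2)] by linarith
qed

text \<open>
  This is Tits's sign lemma, relative to a parabolic subgroup.  Induction on the length: unless
  \<open>w = 1\<close> there is a left descent \<open>j\<close>.  Strip letters \<open>j, i, j, ...\<close> from the left of \<open>w\<close> until an
  element \<open>x\<close> with neither \<open>i\<close> nor \<open>j\<close> as left descent is reached.  The induction hypothesis makes both
  coordinates of \<open>x v\<close> positive, and an explicit computation in rank two finishes the proof; too many
  stripped letters would contradict \<open>s i w\<close> being longer than \<open>w\<close>.  Only the braid relations in the
  group are used, so no faithfulness is presupposed; it is a consequence (\<open>gact_positive_imp_one\<close>).
\<close>

lemma ascent_positive:
  assumes J: "J \<subseteq> I" and v: "\<And>j. j \<in> J \<Longrightarrow> v j > 0"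
  shows "w \<in> wp ` lists J \<Longrightarrow> i \<in> J \<Longrightarrow> len J (s i \<otimes> w) > len J w \<Longrightarrow> gact w v i > 0"
proof (induction "len J w" arbitrary: w i rule: less_induct)
  case less
  have wc: "w \<in> carrier G" using parabolic_closed[OF J] less.prems by auto
  show ?case
  proof (cases "w = \<one>")
    case True
    then show ?thesis using v less.prems by simp
  next
    case False
    then obtain j where j: "j \<in> J" "len J w = Suc (len J (s j \<otimes> w))"
      using left_descent_exists[OF J] less.prems by blast
    have ij: "i \<noteq> j" using less.prems j by auto
    have ijI: "i \<in> I" "j \<in> I" using less.prems j J by auto
    define x where "x = s j \<otimes> w"
    have x: "x \<in> wp ` lists J" "x \<in> carrier G" "w = s j \<otimes> x"
      using mult_in_parabolic[OF j(1) less.prems(1)] wc ijI by (auto simp: x_def)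
    have lx: "len J w = Suc (len J x)" using j x_def by simp
    have wj: "gact w v = reflect m j (gact x v)" using x ijI gact_s_mult by auto
    have xj: "gact x v j > 0" using less.hyps[of x j] x lx j by simp
    show ?thesis
    proof (cases "len J (s i \<otimes> x) > len J x")
      case True
      then have "gact x v i > 0" using less.hyps[of x i] x lx less.prems by simp
      moreover have "cartan m j i \<le> 0" using ij by (simp add: cartan_def)
      ultimately show ?thesis using xj mult_nonpos_nonneg[of "cartan m j i" "gact x v j"]
        by (simp add: wj reflect_def)
    next
      case False
      define y where "y = s i \<otimes> x"
      have ly: "len J x = Suc (len J y)" using len_cases[OF J less.prems(2) x(1)] False y_def by auto
      have y: "y \<in> wp ` lists J" "y \<in> carrier G" "x = s i \<otimes> y"
        using mult_in_parabolic[OF less.prems(2) x(1)] x ijI by (auto simp: y_def)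
      have sy: "s j \<otimes> y \<in> wp ` lists J" "s i \<otimes> w \<in> wp ` lists J"
        using mult_in_parabolic y j less.prems by auto
      consider "m i j = 2" | "m i j = 3" using laced ijI ij by blast
      then show ?thesis
      proof cases
        case 1
        have "s i \<otimes> w = s j \<otimes> y"
          using s_commute'[OF ijI 1 x(2)] ijI y(2) unfolding x(3) by (simp add: y(3))
        then have "len J (s i \<otimes> w) \<le> Suc (len J y)" using len_mult_le[OF j(1) y(1)] by simp
        then show ?thesis using less.prems lx ly by simp
      next
        case 2
        note c = cartan_braid[OF ijI 2]
        have wx: "gact w v i = gact y v j"
          using wj y ijI gact_s_mult[of i y] c
          by (simp add: reflect_def) (simp add: cartan_def)
        show ?thesis
        proof (cases "len J (s j \<otimes> y) > len J y")
          case True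
          then show ?thesis using less.hyps[of y j] y lx ly wx j by simp
        next
          case False
          define z where "z = s j \<otimes> y"
          have lz: "len J y = Suc (len J z)" using len_cases[OF J j(1) y(1)] False z_def by auto
          have z: "z \<in> wp ` lists J" "z \<in> carrier G" "y = s j \<otimes> z"
            using sy y ijI by (auto simp: z_def)
          have "s i \<otimes> w = s j \<otimes> (s i \<otimes> z)"
            using s_braid'[OF ijI 2 y(2)] ijI z(2) unfolding x(3) y(3) by (simp add: z(3))
          then have "len J (s i \<otimes> w) \<le> Suc (Suc (len J z))"
            using len_mult_le[OF j(1) mult_in_parabolic[OF less.prems(2) z(1)]]
              len_mult_le[OF less.prems(2) z(1)] by simp
          then show ?thesis using less.prems lx ly lz by simp
        qed
      qed
    qed
  qed
qed

lemma descent_negative: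
  assumes J: "J \<subseteq> I" and v: "\<And>j. j \<in> J \<Longrightarrow> v j > 0"
    and w: "w \<in> wp ` lists J" "i \<in> J" "len J (s i \<otimes> w) < len J w"
  shows "gact w v i < 0"
proof -
  have c: "w \<in> carrier G" "i \<in> I" using parabolic_closed[OF J w(1)] J w by auto
  have "gact (s i \<otimes> w) v i > 0"
    using ascent_positive[OF J v mult_in_parabolic[OF w(2,1)] w(2)] w c by simp
  then show ?thesis using c by (simp add: gact_s_mult reflect_self)
qed

lemma gact_positive_imp_one:
  assumes J: "J \<subseteq> I" and v: "\<And>j. j \<in> J \<Longrightarrow> v j > 0"
    and w: "w \<in> wp ` lists J" and pos: "\<And>j. j \<in> J \<Longrightarrow> gact w v j \<ge> 0"
  shows "w = \<one>"
proof (rule ccontr)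
  assume "w \<noteq> \<one>"
  then obtain j where j: "j \<in> J" "len J w = Suc (len J (s j \<otimes> w))"
    using left_descent_exists[OF J w] by blast
  then have "gact w v j < 0" using descent_negative[OF J v w] by simp
  then show False using pos[OF j(1)] by simp
qed

abbreviation \<rho> :: "'i \<Rightarrow> int" where "\<rho> \<equiv> rho I"

lemma gact_inv: "g \<in> carrier G \<Longrightarrow> gact (inv g) (gact g v) = v"
  by (simp flip: gact_mult)

lemma act_cong:
  assumes "u \<in> lists I" "\<And>i. i \<in> I \<Longrightarrow> v i = w i" "i \<in> I"
  shows "foldr (reflect m) u v i = foldr (reflect m) u w i"
  using assms by (induction u arbitrary: i) (auto simp: reflect_def)

text \<open>
  The action on the orbit of \<open>\<rho>\<close> is free, since \<open>\<rho>\<close> has only positive coordinates in \<open>I\<close>.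
\<close>

lemma gact_rho_inj:
  assumes g: "g \<in> carrier G" "h \<in> carrier G" and eq: "\<And>i. i \<in> I \<Longrightarrow> gact g \<rho> i = gact h \<rho> i"
  shows "g = h"
proof -
  obtain u where u: "u \<in> lists I" "inv h = wp u" using g carrier_eq_wp by (metis imageE inv_closed)
  have "gact (inv h \<otimes> g) \<rho> i = 1" if i: "i \<in> I" for i
  proof -
    have "gact (inv h \<otimes> g) \<rho> i = gact (inv h) (gact g \<rho>) i" using g by (simp add: gact_mult)
    also have "\<dots> = gact (inv h) (gact h \<rho>) i"
      using act_cong[OF u(1) eq i] by (simp add: u gact_wp)
    finally show ?thesis using g i by (simp add: gact_inv rho_def)
  qed
  moreover have "inv h \<otimes> g \<in> wp ` lists I" using g by (simp flip: carrier_eq_wp)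
  ultimately have "inv h \<otimes> g = \<one>"
    by (intro gact_positive_imp_one[of I \<rho>]) (auto simp: rho_def)
  then show ?thesis using g by (metis inv_closed inv_equality inv_inv)
qed

lemma length_descent_iff:
  assumes "i \<in> I" "g \<in> carrier G"
  shows "gact g \<rho> i < 0 \<longleftrightarrow> len I (s i \<otimes> g) < len I g"
    and "gact g \<rho> i > 0 \<longleftrightarrow> len I g < len I (s i \<otimes> g)"
proof -
  have g: "g \<in> wp ` lists I" using assms carrier_eq_wp by simp
  have "len I g < len I (s i \<otimes> g) \<Longrightarrow> gact g \<rho> i > 0"
    using ascent_positive[of I \<rho> g i] g assms by (simp add: rho_def)
  moreover have "len I (s i \<otimes> g) < len I g \<Longrightarrow> gact g \<rho> i < 0"
    using descent_negative[of I \<rho> g i] g assms by (simp add: rho_def)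
  moreover have "len I (s i \<otimes> g) \<noteq> len I g" using len_mult_neq[of I i g] g assms by simp
  ultimately show "gact g \<rho> i < 0 \<longleftrightarrow> len I (s i \<otimes> g) < len I g"
    "gact g \<rho> i > 0 \<longleftrightarrow> len I g < len I (s i \<otimes> g)" by linarith+
qed

section \<open>Matsumoto's theorem\<close>

definition reduced_word :: "'i set \<Rightarrow> 'i list \<Rightarrow> bool" where
  "reduced_word J u \<longleftrightarrow> u \<in> lists J \<and> length u = len J (wp u)"

lemma reduced_word_exists:
  assumes "w \<in> wp ` lists J"
  obtains u where "reduced_word J u" "wp u = w"
  using len_word[OF assms] by (metis reduced_word_def)

lemma reduced_word_lists: "reduced_word J u \<Longrightarrow> u \<in> lists J"
  by (simp add: reduced_word_def)

lemma reduced_word_ConsD: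
  assumes "reduced_word J (i # u)"
  shows "reduced_word J u" and "i \<in> J" and "len J (s i \<otimes> wp u) = Suc (len J (wp u))"
proof -
  have u: "u \<in> lists J" and i: "i \<in> J" using assms by (auto simp: reduced_word_def)
  have "Suc (length u) = len J (s i \<otimes> wp u)" using assms by (simp add: reduced_word_def)
  moreover have "len J (s i \<otimes> wp u) \<le> Suc (len J (wp u))" using len_mult_le[of i J "wp u"] u i by auto
  moreover have "len J (wp u) \<le> length u" using len_le[OF u] .
  ultimately show "reduced_word J u" "i \<in> J" "len J (s i \<otimes> wp u) = Suc (len J (wp u))"
    using u i by (auto simp: reduced_word_def)
qed

lemma reduced_word_same_length:
  assumes "reduced_word J v" "u \<in> lists J" "wp u = wp v" "length u = length v"
  shows "reduced_word J u"
  using assms by (simp add: reduced_word_def)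

lemma dem_reduced:
  assumes J: "J \<subseteq> I" and v: "\<And>j. j \<in> J \<Longrightarrow> v j > 0"
  shows "reduced_word J u \<Longrightarrow> foldr (dem m) u v = foldr (reflect m) u v"
proof (induction u)
  case (Cons i u)
  note R = reduced_word_ConsD[OF Cons.prems]
  have u: "u \<in> lists J" using R by (simp add: reduced_word_def)
  then have uI: "u \<in> lists I" using J lists_mono by blast
  have "gact (wp u) v i > 0" using ascent_positive[OF J v _ R(2)] R(3) u by auto
  then show ?case using Cons.IH R(1) uI by (simp add: gact_wp dem_def)
qed simp

lemma descent_word:
  assumes "g \<in> carrier G" "i \<in> I" "gact g \<rho> i < 0"
  obtains u where "reduced_word I (i # u)" "wp (i # u) = g" "wp u = s i \<otimes> g"
proof -
  have d: "len I (s i \<otimes> g) < len I g" using assms length_descent_iff by simp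
  obtain u where u: "reduced_word I u" "wp u = s i \<otimes> g"
    using reduced_word_exists[of "s i \<otimes> g" I] assms by (auto simp flip: carrier_eq_wp)
  have w: "wp (i # u) = g" using u assms by simp
  have ul: "u \<in> lists I" using u reduced_word_lists by blast
  have "len I g \<le> Suc (length u)" using len_le[of "i # u" I] w ul assms by simp
  then have "reduced_word I (i # u)" using d u w ul assms by (simp add: reduced_word_def)
  then show ?thesis using that u w by blast
qed

text \<open>
  If the first letters \<open>i\<close> and \<open>j\<close> differ, the weight of the common value \<open>g\<close> has negative coordinates
  at \<open>i\<close> and at \<open>j\<close>.  Reflecting at \<open>i\<close> and \<open>j\<close> alternately, the signs stay negative until the whole
  longest element of the rank two subgroup has been stripped from \<open>g\<close>.  So \<open>g\<close> has reduced words
  beginning with either alternating word and ending in the same word \<open>t\<close>.  They are connected by a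
  braid relation, and each is connected with one of the given words by the induction hypothesis,
  because it has the same first letter.
\<close>

lemma matsumoto:
  "reduced_word I u \<Longrightarrow> reduced_word I v \<Longrightarrow> wp u = wp v \<Longrightarrow> hecke_equiv I m u v"
proof (induction "length u" arbitrary: u v rule: less_induct)
  case less
  have len: "length u = length v" using less.prems by (simp add: reduced_word_def)
  show ?case
  proof (cases u)
    case Nil
    then show ?thesis using len by (auto intro: hecke_refl)
  next
    case (Cons i u')
    then obtain j v' where v: "v = j # v'" using len by (cases v) auto
    note u = Cons
    note RU = reduced_word_ConsD[OF less.prems(1)[unfolded u]]
    note RV = reduced_word_ConsD[OF less.prems(2)[unfolded v]]
    have lists: "u' \<in> lists I" "v' \<in> lists I" using RU RV reduced_word_lists by blast+
    define g where "g = wp u"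
    have gu: "g = s i \<otimes> wp u'" and gv: "g = s j \<otimes> wp v'" using u v less.prems(3) by (simp_all add: g_def)
    have g: "g \<in> carrier G" using gu lists RU(2) by simp
    have su: "s i \<otimes> g = wp u'" unfolding gu using lists RU(2) by simp
    have sv: "s j \<otimes> g = wp v'" unfolding gv using lists RV(2) by simp
    have IH: "hecke_equiv I m x y"
      if "reduced_word I x" "y \<in> lists I" "wp y = wp x" "length y = length x" "length x < length u" for x y
      using less.hyps[OF that(5) that(1) reduced_word_same_length[OF that(1-4)]] that(3) by simp
    show ?thesis
    proof (cases "i = j")
      case True
      then have "wp v' = wp u'" using su sv by simp
      then have "hecke_equiv I m u' v'" using IH RU(1) lists u v len by simp
      then show ?thesis using hecke_Cons RU(2) u v True by simp
    next
      case False
      have neg: "gact g \<rho> i < 0" "gact g \<rho> j < 0"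
        using length_descent_iff(1) RU(2,3) RV(2,3) g su sv gu gv by simp_all
      consider "m i j = 2" | "m i j = 3" using laced RU(2) RV(2) False by blast
      then show ?thesis
      proof cases
        case 1
        note c = cartan_commute[OF RU(2) RV(2) 1]
        have "gact (s i \<otimes> g) \<rho> j < 0" using neg c RU(2) g by (simp add: gact_s_mult reflect_def)
        then obtain t where t: "reduced_word I (j # t)" "wp (j # t) = s i \<otimes> g" "wp t = s j \<otimes> (s i \<otimes> g)"
          using descent_word[of "s i \<otimes> g" j] g RU(2) RV(2) by auto
        have tl: "t \<in> lists I" using reduced_word_lists[OF t(1)] by simp
        have lt: "length (j # t) = length u'"
          using t su RU(1) by (metis reduced_word_def)
        have "s i \<otimes> (s j \<otimes> (s i \<otimes> g)) = s j \<otimes> g"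
          using s_commute'[OF RU(2) RV(2) 1, of "s i \<otimes> g"] g RU(2) by simp
        then have wt: "wp (i # t) = wp v'" using t sv by simp
        have "hecke_equiv I m u' (j # t)"
          using IH[OF RU(1), of "j # t"] t su lt tl RV(2) u by simp
        then have A: "hecke_equiv I m u (i # j # t)" using u RU(2) hecke_Cons by simp
        have "hecke_equiv I m v' (i # t)"
          using IH[OF RV(1), of "i # t"] wt lt tl RU(2) u v len by simp
        then have B: "hecke_equiv I m v (j # i # t)" using v RV(2) hecke_Cons by simp
        have "hecke_equiv I m ([i, j] @ t) ([j, i] @ t)"
          using hecke_append[OF hecke_braid[OF RU(2) RV(2), of m] hecke_refl[OF tl]] 1
            m_sym[OF RU(2) RV(2)] by (simp add: numeral_2_eq_2)
        then show ?thesis using A B by (auto intro: hecke_trans hecke_sym)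
      next
        case 2
        note c = cartan_braid[OF RU(2) RV(2) 2]
        have "gact (s i \<otimes> g) \<rho> j < 0" using neg c RU(2) g by (simp add: gact_s_mult reflect_def)
        then obtain t1 where t1: "reduced_word I (j # t1)" "wp (j # t1) = s i \<otimes> g" "wp t1 = s j \<otimes> (s i \<otimes> g)"
          using descent_word[of "s i \<otimes> g" j] g RU(2) RV(2) by auto
        note t1R = reduced_word_ConsD[OF t1(1)]
        have "gact (wp t1) \<rho> i = gact g \<rho> j"
          using c RU(2) RV(2) g by (simp add: t1(3) gact_s_mult) (simp add: reflect_def cartan_def)
        then obtain t where t: "reduced_word I (i # t)" "wp (i # t) = wp t1" "wp t = s i \<otimes> wp t1"
          using descent_word[of "wp t1" i] neg t1R RU(2) reduced_word_lists
          by (metis wp_closed)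
        have tl: "t \<in> lists I" using reduced_word_lists[OF t(1)] by simp
        have "length (i # t) = length t1" using t t1R(1) by (metis reduced_word_def)
        moreover have "length (j # t1) = length u'" using t1 su RU(1) by (metis reduced_word_def)
        ultimately have lt: "length (j # i # t) = length u'" by simp
        have wu: "wp (j # i # t) = wp u'" using t t1 su by simp
        have "s i \<otimes> (s j \<otimes> (s i \<otimes> (s j \<otimes> (s i \<otimes> g)))) = s j \<otimes> g"
          using s_braid'[OF RU(2) RV(2) 2, of "s j \<otimes> (s i \<otimes> g)"] g RU(2) RV(2) by simp
        then have wt: "wp (i # j # t) = wp v'" using t t1 sv by simp
        have "hecke_equiv I m u' (j # i # t)"
          using IH[OF RU(1), of "j # i # t"] wu lt tl RV(2) RU(2) u by simp
        then have A: "hecke_equiv I m u (i # j # i # t)" using u RU(2) hecke_Cons by simp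
        have "hecke_equiv I m v' (i # j # t)"
          using IH[OF RV(1), of "i # j # t"] wt lt tl RU(2) RV(2) u v len by simp
        then have B: "hecke_equiv I m v (j # i # j # t)" using v RV(2) hecke_Cons by simp
        have "hecke_equiv I m ([i, j, i] @ t) ([j, i, j] @ t)"
          using hecke_append[OF hecke_braid[OF RU(2) RV(2), of m] hecke_refl[OF tl]] 2
            m_sym[OF RU(2) RV(2)] by (simp add: numeral_3_eq_3)
        then show ?thesis using A B by (auto intro: hecke_trans hecke_sym)
      qed
    qed
  qed
qed

lemma hecke_reduced:
  "u \<in> lists I \<Longrightarrow> \<exists>r. reduced_word I r \<and> hecke_equiv I m r u"
proof (induction u)
  case Nil
  have "reduced_word I []" using len_le[of "[]" I] by (simp add: reduced_word_def)
  then show ?case by (auto intro: hecke_refl)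
next
  case (Cons i u)
  then obtain r where r: "reduced_word I r" "hecke_equiv I m r u" and i: "i \<in> I" by auto
  have rl: "r \<in> lists I" "wp r \<in> carrier G" using r reduced_word_lists by auto
  have iu: "hecke_equiv I m (i # r) (i # u)" using hecke_Cons[OF i r(2)] .
  show ?case
  proof (cases "gact (wp r) \<rho> i < 0")
    case False
    then have "len I (s i \<otimes> wp r) = Suc (len I (wp r))"
      using len_cases[of I i "wp r"] length_descent_iff[OF i rl(2)] i rl(1) by auto
    then have "reduced_word I (i # r)" using r(1) i by (simp add: reduced_word_def)
    then show ?thesis using iu by blast
  next
    case True
    then obtain t where t: "reduced_word I (i # t)" "wp (i # t) = wp r"
      using descent_word[OF rl(2) i] by blast
    have "hecke_equiv I m (i # t) r" using matsumoto t r(1) by blast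
    then have "hecke_equiv I m (i # i # t) (i # u)" using hecke_Cons[OF i] iu hecke_trans by blast
    moreover have "hecke_equiv I m ([i, i] @ t) ([i] @ t)"
      using hecke_append[OF hecke_idem[OF i] hecke_refl[of t]] reduced_word_lists[OF t(1)] by simp
    ultimately have "hecke_equiv I m (i # t) (i # u)" by (auto intro: hecke_trans hecke_sym)
    then show ?thesis using t by blast
  qed
qed

lemma hecke_equiv_iff_dem:
  assumes "u \<in> lists I" "v \<in> lists I"
  shows "hecke_equiv I m u v \<longleftrightarrow> (\<forall>i\<in>I. foldr (dem m) u \<rho> i = foldr (dem m) v \<rho> i)"
proof
  assume "hecke_equiv I m u v"
  then show "\<forall>i\<in>I. foldr (dem m) u \<rho> i = foldr (dem m) v \<rho> i" by (simp add: dem_respects)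
next
  assume eq: "\<forall>i\<in>I. foldr (dem m) u \<rho> i = foldr (dem m) v \<rho> i"
  obtain p q where p: "reduced_word I p" "hecke_equiv I m p u" and q: "reduced_word I q" "hecke_equiv I m q v"
    using hecke_reduced assms by meson
  have *: "foldr (dem m) r \<rho> = gact (wp r) \<rho>" if "reduced_word I r" for r
    using dem_reduced[of I \<rho> r] that reduced_word_lists[OF that] by (simp add: rho_def gact_wp)
  have "gact (wp p) \<rho> i = gact (wp q) \<rho> i" if "i \<in> I" for i
    using eq that dem_respects[OF p(2)] dem_respects[OF q(2)] *[OF p(1)] *[OF q(1)] by simp
  then have "wp p = wp q" using gact_rho_inj p q reduced_word_lists wp_closed by meson
  then have "hecke_equiv I m p q" using matsumoto p q by blast
  then show "hecke_equiv I m u v" using p q by (meson hecke_trans hecke_sym)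
qed

text \<open>
  The product of the letters of \<open>u\<close> in the 0-Hecke monoid is \<open>g\<close>.  The word \<open>u\<close> need not be reduced,
  and its product \<open>wp u\<close> in the group may differ from \<open>g\<close>.
\<close>

definition represents :: "'i list \<Rightarrow> 'a \<Rightarrow> bool" where
  "represents u g \<longleftrightarrow> u \<in> lists I \<and> g \<in> carrier G \<and> foldr (dem m) u \<rho> = gact g \<rho>"

lemma represents_reduced: 
  assumes "reduced_word I u" 
  shows "represents u (wp u)"
  using dem_reduced[of I \<rho> u] assms reduced_word_lists[OF assms]
  by (simp add: represents_def rho_def gact_wp)

lemma represents_hecke: "represents u g \<Longrightarrow> represents v g \<Longrightarrow> hecke_equiv I m u v"
  by (simp add: represents_def hecke_equiv_iff_dem)

lemma represents_trans: "represents u g \<Longrightarrow> hecke_equiv I m u v \<Longrightarrow> represents v g"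
  using hecke_equiv_lists[of I m u v] dem_respects[of u v] by (simp add: represents_def)

lemma represents_word: 
  assumes "g \<in> carrier G" obtains u where "reduced_word I u" "wp u = g" "represents u g"
  using reduced_word_exists[of g I] assms carrier_eq_wp represents_reduced by blast

lemma wp_rev: "u \<in> lists I \<Longrightarrow> wp (rev u) = inv (wp u)"
proof (induction u)
  case (Cons i u)
  then have "rev u \<in> lists I" "i \<in> I" "u \<in> lists I" by auto
  then show ?case using Cons.IH by (simp add: wp_append inv_mult_group s_inv)
qed simp

lemma len_inv:
  assumes "g \<in> carrier G"
  shows "len I (inv g) = len I g"
proof -
  have *: "len I (inv h) \<le> len I h" if "h \<in> carrier G" for h
  proof -
    have "h \<in> wp ` lists I" using that by (simp flip: carrier_eq_wp)
    then obtain u where u: "u \<in> lists I" "wp u = h" "length u = len I h" by (rule len_word)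
    have "rev u \<in> lists I" using u by auto
    then show ?thesis using len_le[of "rev u" I] wp_rev u by simp
  qed
  show ?thesis using *[of g] *[of "inv g"] assms by simp
qed

text \<open>
  The relations of the 0-Hecke monoid are stable under reversal of words, so reversal corresponds to
  inversion.
\<close>

lemma represents_rev:
  assumes "represents u g"
  shows "represents (rev u) (inv g)"
proof -
  have g: "g \<in> carrier G" using assms by (simp add: represents_def)
  obtain r where r: "reduced_word I r" "wp r = g" "represents r g" using represents_word[OF g] .
  have rl: "r \<in> lists I" using reduced_word_lists[OF r(1)] .
  then have "rev r \<in> lists I" by auto
  then have "reduced_word I (rev r)" using r(1) rl wp_rev len_inv by (simp add: reduced_word_def)
  then have "represents (rev r) (inv g)" using represents_reduced wp_rev r rl by metis
  then show ?thesis using represents_trans hecke_rev represents_hecke r(3) assms by blast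
qed

end
section \<open>The free algebra\<close>

abbreviation supp :: "('w \<Rightarrow> 'k::zero) \<Rightarrow> 'w set" where "supp f \<equiv> {w. f w \<noteq> 0}"

lemma free_algebra_simps:
  "f \<in> carrier (free_algebra I) \<longleftrightarrow> finite (supp f) \<and> supp f \<subseteq> lists I"
  "mult (free_algebra I) f g = (\<lambda>w. \<Sum>k\<le>length w. f (take k w) * g (drop k w))"
  "one (free_algebra I) = (\<lambda>w. if w = [] then 1 else 0)"
  "zero (free_algebra I) = (\<lambda>w. 0)"
  "add (free_algebra I) f g = (\<lambda>w. f w + g w)"
  by (simp_all add: free_algebra_def)

lemma mult_nonzero_split:
  assumes "mult (free_algebra I) f g w \<noteq> 0"
  obtains a b where "w = a @ b" "f a \<noteq> 0" "g b \<noteq> 0"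
proof -
  obtain k where "f (take k w) * g (drop k w) \<noteq> 0"
    using assms unfolding free_algebra_simps by (rule sum.not_neutral_contains_not_neutral)
  then have "f (take k w) \<noteq> 0" "g (drop k w) \<noteq> 0" by auto
  then show ?thesis using that[of "take k w" "drop k w"] by simp
qed

lemma supp_mult_subset:
  "supp (mult (free_algebra I) f g) \<subseteq> (\<lambda>(a, b). a @ b) ` (supp f \<times> supp g)"
  by (rule subsetI) (force elim: mult_nonzero_split)

lemma free_algebra_mult_closed:
  assumes "f \<in> carrier (free_algebra I)" "g \<in> carrier (free_algebra I)"
  shows "mult (free_algebra I) f g \<in> carrier (free_algebra I)"
proof -
  have "finite (supp (mult (free_algebra I) f g))"
    using assms by (intro finite_subset[OF supp_mult_subset]) (auto simp: free_algebra_simps(1))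
  moreover have "supp (mult (free_algebra I) f g) \<subseteq> lists I"
  proof
    fix w assume "w \<in> supp (mult (free_algebra I) f g)"
    then obtain a b where "w = a @ b" "f a \<noteq> 0" "g b \<noteq> 0" by (auto elim: mult_nonzero_split)
    moreover then have "a \<in> lists I" "b \<in> lists I" using assms by (auto simp: free_algebra_simps(1))
    ultimately show "w \<in> lists I" by simp
  qed
  ultimately show ?thesis by (simp add: free_algebra_simps(1))
qed

text \<open>
  Both sides sum over all ways to cut \<open>w\<close> into three pieces; \<open>i\<close> and \<open>j\<close> are the lengths of the
  first two.
\<close>

lemma free_algebra_assoc:
  fixes f g h :: "'i list \<Rightarrow> 'k::comm_ring_1"
  shows "mult (free_algebra I) (mult (free_algebra I) f g) h
    = mult (free_algebra I) f (mult (free_algebra I) g h)"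
proof
  fix w :: "'i list"
  define n where "n = length w"
  define F where "F i j = f (take i w) * (g (take j (drop i w)) * h (drop (i + j) w))" for i j
  have "mult (free_algebra I) (mult (free_algebra I) f g) h w
      = (\<Sum>k\<le>n. \<Sum>i\<le>k. F i (k - i))"
    unfolding free_algebra_simps n_def
    by (intro sum.cong refl)
      (auto simp: sum_distrib_right F_def min_def mult.assoc drop_take intro!: sum.cong)
  also have "\<dots> = (\<Sum>(i, j) | i + j \<le> n. F i j)"
    by (rule sum.triangle_reindex_eq[symmetric])
  also have "\<dots> = (\<Sum>(i, j) \<in> (SIGMA i:{..n}. {..n - i}). F i j)"
    by (rule sum.cong) auto
  also have "\<dots> = (\<Sum>i\<le>n. \<Sum>j\<le>n - i. F i j)"
    by (subst sum.Sigma) auto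
  also have "\<dots> = mult (free_algebra I) f (mult (free_algebra I) g h) w"
    unfolding free_algebra_simps n_def
    by (intro sum.cong refl) (auto simp: sum_distrib_left F_def add.commute)
  finally show "mult (free_algebra I) (mult (free_algebra I) f g) h w
    = mult (free_algebra I) f (mult (free_algebra I) g h) w" .
qed

lemma free_algebra_l_one:
  fixes f :: "'i list \<Rightarrow> 'k::comm_ring_1"
  shows "mult (free_algebra I) (one (free_algebra I)) f = f"
proof
  fix w :: "'i list"
  have "mult (free_algebra I) (one (free_algebra I)) f w = (\<Sum>k\<le>length w. if k = 0 then f w else 0)"
    unfolding free_algebra_simps by (intro sum.cong refl) auto
  then show "mult (free_algebra I) (one (free_algebra I)) f w = f w" by simp
qed

lemma free_algebra_r_one:
  fixes f :: "'i list \<Rightarrow> 'k::comm_ring_1"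
  shows "mult (free_algebra I) f (one (free_algebra I)) = f"
proof
  fix w :: "'i list"
  have "mult (free_algebra I) f (one (free_algebra I)) w
      = (\<Sum>k\<le>length w. if k = length w then f w else 0)"
    unfolding free_algebra_simps by (intro sum.cong refl) auto
  then show "mult (free_algebra I) f (one (free_algebra I)) w = f w" by simp
qed

lemma free_algebra_add_closed:
  fixes f g :: "'i list \<Rightarrow> 'k::comm_ring_1"
  assumes "f \<in> carrier (free_algebra I)" "g \<in> carrier (free_algebra I)"
  shows "add (free_algebra I) f g \<in> carrier (free_algebra I)"
proof -
  have "supp (\<lambda>w. f w + g w) \<subseteq> supp f \<union> supp g" by auto
  then show ?thesis using assms finite_subset
    unfolding free_algebra_simps by (metis (no_types, lifting) finite_UnI le_sup_iff order_trans)
qed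

lemma free_algebra_uminus_closed:
  fixes f :: "'i list \<Rightarrow> 'k::comm_ring_1"
  shows "f \<in> carrier (free_algebra I) \<Longrightarrow> (\<lambda>w. - f w) \<in> carrier (free_algebra I)"
  by (simp add: free_algebra_simps)

lemma free_algebra_ring: "ring (free_algebra I :: ('i list \<Rightarrow> 'k::comm_ring_1) ring)"
proof (rule ringI)
  show "abelian_group (free_algebra I :: ('i list \<Rightarrow> 'k) ring)"
  proof (rule abelian_groupI)
    fix f :: "'i list \<Rightarrow> 'k" assume "f \<in> carrier (free_algebra I)"
    then show "\<exists>g\<in>carrier (free_algebra I). g \<oplus>\<^bsub>free_algebra I\<^esub> f = \<zero>\<^bsub>free_algebra I\<^esub>"
      using free_algebra_uminus_closed by (intro bexI[of _ "\<lambda>w. - f w"]) (auto simp: free_algebra_simps)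
  qed (simp_all add: free_algebra_add_closed, simp_all add: free_algebra_simps add_ac)
  show "monoid (free_algebra I :: ('i list \<Rightarrow> 'k) ring)"
    by (rule monoidI) (simp_all add: free_algebra_mult_closed free_algebra_assoc
        free_algebra_l_one free_algebra_r_one, simp_all add: free_algebra_simps)
qed (simp_all add: free_algebra_simps distrib_right distrib_left sum.distrib)

lemma free_algebra_a_inv:
  fixes f :: "'i list \<Rightarrow> 'k::comm_ring_1"
  assumes "f \<in> carrier (free_algebra I)"
  shows "\<ominus>\<^bsub>free_algebra I\<^esub> f = (\<lambda>w. - f w)"
proof -
  interpret ring "free_algebra I :: ('i list \<Rightarrow> 'k) ring" by (rule free_algebra_ring)
  show ?thesis
    using assms free_algebra_uminus_closed[OF assms]
    by (intro minus_equality) (auto simp: free_algebra_simps(4,5))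
qed

lemma word_elt_closed: "u \<in> lists I \<Longrightarrow> word_elt u \<in> carrier (free_algebra I)"
  by (auto simp: free_algebra_simps word_elt_def)

lemma word_elt_mult:
  "mult (free_algebra I) (word_elt u) (word_elt v) = (word_elt (u @ v) :: 'i list \<Rightarrow> 'k::comm_ring_1)"
proof
  fix w :: "'i list"
  have split: "take k w = u \<and> drop k w = v \<longleftrightarrow> k = length u \<and> w = u @ v" if "k \<le> length w" for k
  proof (cases "k = length u")
    case True
    then show ?thesis by (auto simp: append_eq_conv_conj eq_commute[of w])
  next
    case False
    then show ?thesis using that by auto
  qed
  have "mult (free_algebra I) (word_elt u) (word_elt v) w
      = (\<Sum>k\<le>length w. if take k w = u \<and> drop k w = v then 1 else (0::'k))"
    unfolding free_algebra_simps word_elt_def by (intro sum.cong refl) auto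
  also have "\<dots> = (\<Sum>k\<le>length w. if k = length u then if w = u @ v then 1 else 0 else 0)"
    by (intro sum.cong refl) (simp add: split)
  finally have "mult (free_algebra I) (word_elt u) (word_elt v) w
      = (\<Sum>k\<le>length w. if k = length u then if w = u @ v then 1 else 0 else (0::'k))" .
  then show "mult (free_algebra I) (word_elt u) (word_elt v) w = (word_elt (u @ v) w :: 'k)"
    by (simp add: word_elt_def)
qed

text \<open>
  The value at \<open>f\<close> of the linear form on the free algebra which sends each word \<open>w\<close> to \<open>F w\<close>.
\<close>

definition pairing :: "('w \<Rightarrow> 'k::comm_ring_1) \<Rightarrow> ('w \<Rightarrow> 'k) \<Rightarrow> 'k" where
  "pairing f F = (\<Sum>w\<in>supp f. f w * F w)"

lemma pairing_superset: "finite A \<Longrightarrow> supp f \<subseteq> A \<Longrightarrow> pairing f F = (\<Sum>w\<in>A. f w * F w)"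
  unfolding pairing_def by (rule sum.mono_neutral_left) auto

lemma pairing_add:
  assumes "finite (supp f)" "finite (supp g)"
  shows "pairing (\<lambda>w. f w + g w) F = pairing f F + pairing g F"
proof -
  let ?A = "supp f \<union> supp g"
  have "finite ?A" using assms by simp
  then show ?thesis
    by (subst (1 2 3) pairing_superset[of ?A]) (auto simp: sum.distrib distrib_right)
qed

lemma pairing_uminus: "pairing (\<lambda>w. - f w) F = - pairing f F"
  by (simp add: pairing_def sum_negf)

lemma pairing_word_diff:
  "pairing (\<lambda>w. word_elt u w - word_elt v w) F = F u - F v"
proof -
  have "pairing (\<lambda>w. word_elt u w - word_elt v w) F = (\<Sum>w\<in>{u, v}. (word_elt u w - word_elt v w) * F w)"
    by (rule pairing_superset) (auto simp: word_elt_def split: if_splits)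
  then show ?thesis by (cases "u = v") (auto simp: word_elt_def)
qed

lemma mult_eq_sum_pairs:
  assumes "finite (supp f)" "finite (supp g)"
  shows "mult (free_algebra I) f g w = (\<Sum>(a, b) \<in> {p \<in> supp f \<times> supp g. fst p @ snd p = w}. f a * g b)"
proof -
  have "mult (free_algebra I) f g w
      = (\<Sum>k\<in>{k. k \<le> length w \<and> f (take k w) \<noteq> 0 \<and> g (drop k w) \<noteq> 0}. f (take k w) * g (drop k w))"
    unfolding free_algebra_simps by (rule sum.mono_neutral_right) auto
  also have "\<dots> = (\<Sum>(a, b) \<in> {p \<in> supp f \<times> supp g. fst p @ snd p = w}. f a * g b)"
    by (rule sum.reindex_bij_witness[of _ "\<lambda>(a, b). length a" "\<lambda>k. (take k w, drop k w)"])
      (auto simp: min_def)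
  finally show ?thesis .
qed

lemma pairing_mult:
  assumes "finite (supp f)" "finite (supp g)"
  shows "pairing (mult (free_algebra I) f g) F
    = (\<Sum>(a, b) \<in> supp f \<times> supp g. f a * g b * F (a @ b))"
proof -
  let ?S = "supp f \<times> supp g" and ?app = "\<lambda>p. fst p @ snd p"
  have fin: "finite ?S" using assms by simp
  have sub: "supp (mult (free_algebra I) f g) \<subseteq> ?app ` ?S"
    using supp_mult_subset[of I f g] by (simp add: case_prod_unfold)
  have "pairing (mult (free_algebra I) f g) F
      = (\<Sum>w\<in>?app ` ?S. mult (free_algebra I) f g w * F w)"
    using fin sub by (intro pairing_superset) auto
  also have "\<dots> = (\<Sum>w\<in>?app ` ?S. \<Sum>(a, b) \<in> {p \<in> ?S. ?app p = w}. f a * g b * F (a @ b))"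
    by (intro sum.cong refl)
      (auto simp: mult_eq_sum_pairs[OF assms] sum_distrib_right case_prod_unfold intro!: sum.cong)
  also have "\<dots> = (\<Sum>(a, b) \<in> ?S. f a * g b * F (a @ b))"
    using fin by (intro sum.group) auto
  finally show ?thesis .
qed

lemma pairing_mult_left:
  assumes "finite (supp f)" "finite (supp g)"
  shows "pairing (mult (free_algebra I) f g) F = (\<Sum>a\<in>supp f. f a * pairing g (\<lambda>b. F (a @ b)))"
  unfolding pairing_mult[OF assms]
  by (simp add: pairing_def sum_distrib_left mult.assoc flip: sum.cartesian_product)

lemma pairing_mult_right:
  assumes "finite (supp f)" "finite (supp g)"
  shows "pairing (mult (free_algebra I) f g) F = (\<Sum>b\<in>supp g. g b * pairing f (\<lambda>a. F (a @ b)))"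
  unfolding pairing_mult[OF assms]
  by (subst sum.cartesian_product[symmetric], subst sum.swap)
    (simp add: pairing_def sum_distrib_left ac_simps)

section \<open>The 0-Hecke algebra\<close>

definition hecke_invariant :: "'i set \<Rightarrow> ('i \<Rightarrow> 'i \<Rightarrow> nat) \<Rightarrow> ('i list \<Rightarrow> 'k) \<Rightarrow> bool" where
  "hecke_invariant I m F \<longleftrightarrow> (\<forall>u v. hecke_equiv I m u v \<longrightarrow> F u = F v)"

text \<open>
  The elements killed by all linear forms that are constant on the classes of words.  This is an
  ideal that contains the relators, and it separates words that are not congruent; it thus shows that
  the 0-Hecke algebra does not identify more words than the monoid does.
\<close>

definition hecke_null :: "'i set \<Rightarrow> ('i \<Rightarrow> 'i \<Rightarrow> nat) \<Rightarrow> ('i list \<Rightarrow> 'k::comm_ring_1) set" where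
  "hecke_null I m =
     {f \<in> carrier (free_algebra I). \<forall>F. hecke_invariant I m F \<longrightarrow> pairing f F = 0}"

lemma hecke_invariant_shift:
  assumes "hecke_invariant I m F" "a \<in> lists I"
  shows "hecke_invariant I m (\<lambda>b. F (a @ b))" "hecke_invariant I m (\<lambda>b. F (b @ a))"
  using assms hecke_append hecke_refl[OF assms(2)] unfolding hecke_invariant_def by metis+

lemma hecke_null_ideal: "ideal (hecke_null I m :: ('i list \<Rightarrow> 'k::comm_ring_1) set) (free_algebra I)"
proof -
  interpret R: ring "free_algebra I :: ('i list \<Rightarrow> 'k) ring" by (rule free_algebra_ring)
  show ?thesis
  proof (rule idealI[OF free_algebra_ring])
    show "subgroup (hecke_null I m) (add_monoid (free_algebra I :: ('i list \<Rightarrow> 'k) ring))"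
    proof (rule R.add.subgroupI)
      show "hecke_null I m \<noteq> ({} :: ('i list \<Rightarrow> 'k) set)"
        by (auto simp: hecke_null_def free_algebra_simps pairing_def intro!: exI[of _ "\<lambda>w. 0"])
    next
      fix f :: "'i list \<Rightarrow> 'k" assume "f \<in> hecke_null I m"
      then show "\<ominus>\<^bsub>free_algebra I\<^esub> f \<in> hecke_null I m"
        by (auto simp: hecke_null_def free_algebra_a_inv free_algebra_uminus_closed pairing_uminus)
    next
      fix f g :: "'i list \<Rightarrow> 'k" assume fg: "f \<in> hecke_null I m" "g \<in> hecke_null I m"
      then have fin: "finite (supp f)" "finite (supp g)" by (auto simp: hecke_null_def free_algebra_simps)
      show "f \<oplus>\<^bsub>free_algebra I\<^esub> g \<in> hecke_null I m"
        using fg pairing_add[OF fin] free_algebra_add_closed[of f I g]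
        by (auto simp: hecke_null_def) (simp add: free_algebra_simps(5))
    qed (auto simp: hecke_null_def)
  next
    fix f g :: "'i list \<Rightarrow> 'k" assume f: "f \<in> hecke_null I m" and g: "g \<in> carrier (free_algebra I)"
    have fin: "finite (supp f)" "finite (supp g)" "supp g \<subseteq> lists I"
      using f g by (auto simp: hecke_null_def free_algebra_simps)
    have "pairing (g \<otimes>\<^bsub>free_algebra I\<^esub> f) F = 0" if F: "hecke_invariant I m F" for F
    proof -
      have "pairing f (\<lambda>b. F (a @ b)) = 0" if "a \<in> supp g" for a
        using f fin(3) that hecke_invariant_shift(1)[OF F, of a] unfolding hecke_null_def by blast
      then show ?thesis by (simp add: pairing_mult_left[OF fin(2,1)])
    qed
    then show "g \<otimes>\<^bsub>free_algebra I\<^esub> f \<in> hecke_null I m"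
      using f g by (simp add: hecke_null_def free_algebra_mult_closed)
    have "pairing (f \<otimes>\<^bsub>free_algebra I\<^esub> g) F = 0" if F: "hecke_invariant I m F" for F
    proof -
      have "pairing f (\<lambda>a. F (a @ b)) = 0" if "b \<in> supp g" for b
        using f fin(3) that hecke_invariant_shift(2)[OF F, of b] unfolding hecke_null_def by blast
      then show ?thesis by (simp add: pairing_mult_right[OF fin(1,2)])
    qed
    then show "f \<otimes>\<^bsub>free_algebra I\<^esub> g \<in> hecke_null I m"
      using f g by (simp add: hecke_null_def free_algebra_mult_closed)
  qed
qed

lemma word_diff_eq:
  fixes u v :: "'i list"
  assumes "u \<in> lists I" "v \<in> lists I"
  shows "word_elt u \<ominus>\<^bsub>free_algebra I\<^esub> word_elt v = (\<lambda>w. word_elt u w - word_elt v w :: 'k::comm_ring_1)"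
  using assms word_elt_closed[of v I, where ?'b='k]
  by (simp add: a_minus_def free_algebra_a_inv) (simp add: free_algebra_simps)

lemma word_diff_closed:
  fixes u v :: "'i list"
  assumes "u \<in> lists I" "v \<in> lists I"
  shows "(\<lambda>w. word_elt u w - word_elt v w :: 'k::comm_ring_1) \<in> carrier (free_algebra I)"
proof -
  interpret ring "free_algebra I :: ('i list \<Rightarrow> 'k) ring" by (rule free_algebra_ring)
  show ?thesis using word_diff_eq[OF assms, where ?'k='k] word_elt_closed assms minus_closed by metis
qed

lemma hecke_relators_subset:
  "hecke0_relators I m \<subseteq> (hecke_null I m :: ('i list \<Rightarrow> 'k::comm_ring_1) set)"
proof
  fix f :: "'i list \<Rightarrow> 'k" assume "f \<in> hecke0_relators I m"
  then consider i where "i \<in> I" "f = (\<lambda>w. word_elt [i, i] w - word_elt [i] w)"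
    | i j where "i \<in> I" "j \<in> I"
      "f = (\<lambda>w. word_elt (alternating i j (m i j)) w - word_elt (alternating j i (m i j)) w)"
    unfolding hecke0_relators_def by blast
  then obtain u v where uv: "hecke_equiv I m u v" "f = (\<lambda>w. word_elt u w - word_elt v w)"
  proof cases
    case (1 i)
    show ?thesis by (rule that[OF hecke_idem[OF 1(1)] 1(2)])
  next
    case (2 i j)
    show ?thesis by (rule that[OF hecke_braid[OF 2(1,2)] 2(3)])
  qed
  then show "f \<in> hecke_null I m"
    using hecke_equiv_lists[OF uv(1)] word_diff_closed[of u I v, where ?'k='k]
    by (auto simp: hecke_null_def pairing_word_diff hecke_invariant_def)
qed

lemma hecke0_ideal:
  "ideal (hecke0_ideal I m :: ('i list \<Rightarrow> 'k::comm_ring_1) set) (free_algebra I)"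
  "hecke0_ideal I m \<subseteq> (hecke_null I m :: ('i list \<Rightarrow> 'k::comm_ring_1) set)"
  "hecke0_relators I m \<subseteq> (hecke0_ideal I m :: ('i list \<Rightarrow> 'k::comm_ring_1) set)"
proof -
  interpret ring "free_algebra I :: ('i list \<Rightarrow> 'k) ring" by (rule free_algebra_ring)
  have sub: "hecke0_relators I m \<subseteq> carrier (free_algebra I :: ('i list \<Rightarrow> 'k) ring)"
    using hecke_relators_subset by (auto simp: hecke_null_def)
  show "ideal (hecke0_ideal I m :: ('i list \<Rightarrow> 'k::comm_ring_1) set) (free_algebra I)"
    "hecke0_ideal I m \<subseteq> (hecke_null I m :: ('i list \<Rightarrow> 'k::comm_ring_1) set)"
    "hecke0_relators I m \<subseteq> (hecke0_ideal I m :: ('i list \<Rightarrow> 'k::comm_ring_1) set)"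
    unfolding hecke0_ideal_def
    using genideal_ideal[OF sub] genideal_minimal[OF hecke_null_ideal hecke_relators_subset]
      genideal_self[OF sub] by blast+
qed

definition hecke_word :: "'i set \<Rightarrow> ('i \<Rightarrow> 'i \<Rightarrow> nat) \<Rightarrow> 'i list \<Rightarrow> ('i list \<Rightarrow> 'k::comm_ring_1) set" where
  "hecke_word I m u = word_prod (hecke0_algebra I m) (hecke0_gen I m) u"

lemma hecke_word_eq_coset:
  fixes u :: "'i list"
  assumes "u \<in> lists I"
  shows "hecke_word I m u
    = hecke0_ideal I m +>\<^bsub>free_algebra I\<^esub> (word_elt u :: 'i list \<Rightarrow> 'k::comm_ring_1)"
proof -
  interpret ideal "hecke0_ideal I m :: ('i list \<Rightarrow> 'k) set" "free_algebra I"
    by (rule hecke0_ideal)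
  note hom = rcos_ring_hom
  show ?thesis using assms
  proof (induction u)
    case Nil
    have "word_elt [] = (\<one>\<^bsub>free_algebra I\<^esub> :: 'i list \<Rightarrow> 'k)"
      by (simp add: word_elt_def free_algebra_simps)
    then show ?case
      using ring_hom_one[OF hom] by (simp add: hecke_word_def word_prod_def hecke0_algebra_def)
  next
    case (Cons i u)
    have "(word_elt (i # u) :: 'i list \<Rightarrow> 'k) = word_elt [i] \<otimes>\<^bsub>free_algebra I\<^esub> word_elt u"
      by (simp add: word_elt_mult)
    moreover have "word_elt [i] \<in> carrier (free_algebra I :: ('i list \<Rightarrow> 'k) ring)"
      "word_elt u \<in> carrier (free_algebra I :: ('i list \<Rightarrow> 'k) ring)"
      using Cons by (auto intro!: word_elt_closed)
    ultimately show ?case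
      using Cons ring_hom_mult[OF hom, of "word_elt [i]" "word_elt u"]
      by (simp add: hecke_word_def word_prod_def hecke0_algebra_def hecke0_gen_def)
  qed
qed

lemma hecke_word_append:
  fixes u v :: "'i list"
  assumes "u \<in> lists I" "v \<in> lists I"
  shows "hecke_word I m u \<otimes>\<^bsub>hecke0_algebra I m\<^esub> hecke_word I m v
    = (hecke_word I m (u @ v) :: ('i list \<Rightarrow> 'k::comm_ring_1) set)"
proof -
  interpret ideal "hecke0_ideal I m :: ('i list \<Rightarrow> 'k) set" "free_algebra I"
    by (rule hecke0_ideal)
  show ?thesis
    using ring_hom_mult[OF rcos_ring_hom word_elt_closed[OF assms(1)] word_elt_closed[OF assms(2)]]
    using assms by (simp add: hecke_word_eq_coset word_elt_mult hecke0_algebra_def)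
qed

lemma hecke_word_eq_iff_diff:
  fixes u v :: "'i list"
  assumes "u \<in> lists I" "v \<in> lists I"
  shows "(hecke_word I m u :: ('i list \<Rightarrow> 'k::comm_ring_1) set) = hecke_word I m v
    \<longleftrightarrow> (\<lambda>w. word_elt u w - word_elt v w) \<in> (hecke0_ideal I m :: ('i list \<Rightarrow> 'k) set)"
proof -
  interpret ring "free_algebra I :: ('i list \<Rightarrow> 'k) ring" by (rule free_algebra_ring)
  show ?thesis
    using quotient_eq_iff_same_a_r_cos[OF hecke0_ideal(1) word_elt_closed[OF assms(1)] word_elt_closed[OF assms(2)]]
    by (simp add: hecke_word_eq_coset assms word_diff_eq)
qed

theorem hecke_word_eq_iff:
  fixes u v :: "'i list"
  assumes "u \<in> lists I" "v \<in> lists I"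
  shows "(hecke_word I m u :: ('i list \<Rightarrow> 'k::comm_ring_1) set) = hecke_word I m v \<longleftrightarrow> hecke_equiv I m u v"
proof
  assume "(hecke_word I m u :: ('i list \<Rightarrow> 'k) set) = hecke_word I m v"
  then have "(\<lambda>w. word_elt u w - word_elt v w :: 'k) \<in> hecke_null I m"
    using hecke_word_eq_iff_diff[OF assms] hecke0_ideal(2) by blast
  moreover define F where "F w = (if hecke_equiv I m u w then 1 else 0 :: 'k)" for w
  have "hecke_invariant I m F"
    unfolding hecke_invariant_def F_def by (metis hecke_sym hecke_trans)
  ultimately have "F u - F v = 0"
    by (simp add: hecke_null_def pairing_word_diff)
  then show "hecke_equiv I m u v" using hecke_refl[OF assms(1)] by (simp add: F_def split: if_splits)
next
  assume "hecke_equiv I m u v"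
  then show "(hecke_word I m u :: ('i list \<Rightarrow> 'k) set) = hecke_word I m v"
  proof (induction rule: hecke_equiv.induct)
    case (hecke_idem i)
    have "(\<lambda>w. word_elt [i, i] w - word_elt [i] w) \<in> (hecke0_relators I m :: ('i list \<Rightarrow> 'k) set)"
      using hecke_idem unfolding hecke0_relators_def by blast
    then show ?case using hecke_idem hecke0_ideal(3) by (subst hecke_word_eq_iff_diff) auto
  next
    case (hecke_braid i j)
    have "(\<lambda>w. word_elt (alternating i j (m i j)) w - word_elt (alternating j i (m i j)) w)
        \<in> (hecke0_relators I m :: ('i list \<Rightarrow> 'k) set)"
      using hecke_braid unfolding hecke0_relators_def by blast
    then show ?case using hecke_braid hecke0_ideal(3) 
      by (subst hecke_word_eq_iff_diff) (auto simp: alternating_in_lists simp del: in_lists_conv_set)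
  next
    case (hecke_append u u' v v')
    then show ?case using hecke_equiv_lists by (metis hecke_word_append)
  qed simp_all
qed

section \<open>Longest elements of parabolic subgroups\<close>

lemma dem_eq_act:
  "u \<in> lists J \<Longrightarrow> \<exists>p\<in>lists J. foldr (dem m) u v = foldr (reflect m) p v"
proof (induction u)
  case Nil
  then show ?case by (intro bexI[of _ "[]"]) auto
next
  case (Cons i u)
  then obtain p where "p \<in> lists J" "foldr (dem m) u v = foldr (reflect m) p v" by auto
  note p = this
  show ?case
  proof (cases "foldr (dem m) u v i > 0")
    case True
    then show ?thesis using p Cons.prems by (intro bexI[of _ "i # p"]) (simp_all add: dem_pos)
  next
    case False
    then show ?thesis using p by (intro bexI[of _ p]) (simp_all add: dem_nonpos)
  qed
qed

text \<open>
  A Demazure step that moves a weight can be undone on the negated weight: negation turns the negative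
  coordinate after the step into a positive one.  The steps that do not move the weight are dropped
  from the word.
\<close>

lemma dem_reverse:
  "\<exists>q. set q \<subseteq> set u \<and> foldr (dem m) q (\<lambda>k. - foldr (dem m) u v k) = (\<lambda>k. - v k)"
proof (induction u)
  case (Cons i u)
  define w where "w = foldr (dem m) u v"
  obtain q where q: "set q \<subseteq> set u" "foldr (dem m) q (\<lambda>k. - w k) = (\<lambda>k. - v k)"
    using Cons.IH w_def by auto
  show ?case
  proof (cases "w i > 0")
    case True
    then have "dem m i (\<lambda>k. - dem m i w k) = (\<lambda>k. - w k)"
      by (simp add: dem_def reflect_self reflect_uminus reflect_reflect)
    then show ?thesis using q by (intro exI[of _ "q @ [i]"]) (auto simp flip: w_def)
  next
    case False
    then have "dem m i w = w" by (simp add: dem_def)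
    then show ?thesis using q by (intro exI[of _ q]) (auto simp flip: w_def)
  qed
qed (auto intro: exI[of _ "[]"])

context simply_laced
begin

lemma parabolic_mult:
  assumes J: "J \<subseteq> I" and xy: "x \<in> wp ` lists J" "y \<in> wp ` lists J"
  shows "x \<otimes> y \<in> wp ` lists J"
proof -
  obtain u v where uv: "u \<in> lists J" "x = wp u" "v \<in> lists J" "y = wp v" using xy by blast
  then have "x \<otimes> y = wp (u @ v)" using lists_mono[OF J] by (simp add: wp_append subset_iff)
  moreover have "u @ v \<in> lists J" using uv by simp
  ultimately show ?thesis by blast
qed

lemma parabolic_inv:
  assumes J: "J \<subseteq> I" and x: "x \<in> wp ` lists J"
  shows "inv x \<in> wp ` lists J"
proof -
  obtain u where u: "u \<in> lists J" "x = wp u" using x by blast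
  then have "inv x = wp (rev u)" using lists_mono[OF J] by (simp add: wp_rev subset_iff)
  moreover have "rev u \<in> lists J" using u by auto
  ultimately show ?thesis by blast
qed

lemma dem_ge:
  assumes "u \<in> lists J" "k \<notin> J"
  shows "v k \<le> foldr (dem m) u v k"
  using assms(1)
proof (induction u)
  case (Cons i u)
  then have "cartan m i k \<le> 0" using assms(2) by (auto simp: cartan_def)
  moreover have "v k \<le> foldr (dem m) u v k" using Cons by simp
  ultimately show ?case using mult_nonpos_nonneg[of "cartan m i k" "foldr (dem m) u v i"]
    by (cases "foldr (dem m) u v i > 0") (simp_all add: dem_pos dem_nonpos reflect_def)
qed simp

text \<open>
  The negated weight of \<open>y\<close> is dominant for \<open>J\<close>, and \<open>x y\<inverse>\<close> maps it to another weight that is dominant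
  for \<open>J\<close>.
\<close>

lemma parabolic_antidominant_unique:
  assumes J: "J \<subseteq> I" and x: "x \<in> wp ` lists J" and y: "y \<in> wp ` lists J"
    and neg: "\<And>j. j \<in> J \<Longrightarrow> gact x \<rho> j \<le> 0" "\<And>j. j \<in> J \<Longrightarrow> gact y \<rho> j < 0"
  shows "x = y"
proof -
  have c: "x \<in> carrier G" "y \<in> carrier G" using parabolic_closed J x y by blast+
  have "gact (x \<otimes> inv y) (\<lambda>k. - gact y \<rho> k) = (\<lambda>k. - gact x \<rho> k)"
    using c by (simp add: gact_mult gact_uminus gact_inv)
  then have "x \<otimes> inv y = \<one>"
    using neg J parabolic_mult[OF J x parabolic_inv[OF J y]]
    by (intro gact_positive_imp_one[of J "\<lambda>k. - gact y \<rho> k"]) auto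
  then show ?thesis using c by (metis inv_closed inv_equality inv_inv)
qed

abbreviation longest :: "'i set \<Rightarrow> 'a" where "longest \<equiv> longest_elt G I s"

lemma maximal_antidominant:
  assumes J: "J \<subseteq> I" and w: "w \<in> wp ` lists J"
    and max: "\<And>y. y \<in> wp ` lists J \<Longrightarrow> len I y \<le> len I w" and j: "j \<in> J"
  shows "gact w \<rho> j < 0"
proof -
  have c: "w \<in> carrier G" "j \<in> I" using parabolic_closed J w j by auto
  have "len I (s j \<otimes> w) \<le> len I w" using max mult_in_parabolic[OF j w] .
  moreover have "len I (s j \<otimes> w) \<noteq> len I w"
    using len_mult_neq[of I j w] c by (simp flip: carrier_eq_wp)
  ultimately show ?thesis using length_descent_iff(1)[OF c(2,1)] by simp
qed

lemma longest_maximal: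
  assumes fin: "finite (carrier G)" and J: "J \<subseteq> I"
  shows "longest J \<in> wp ` lists J"
    and "y \<in> wp ` lists J \<Longrightarrow> len I y \<le> len I (longest J)"
proof -
  have "finite (wp ` lists J)" by (rule finite_subset[OF _ fin]) (use parabolic_closed[OF J] in blast)
  then have bound: "\<forall>y. y \<in> wp ` lists J \<longrightarrow> len I y < Suc (Max (len I ` wp ` lists J))"
    by (auto simp: less_Suc_eq_le simp del: in_lists_conv_set intro!: Max_ge)
  have one: "\<one> \<in> wp ` lists J" by (rule image_eqI[of _ _ "[]"]) auto
  have eq: "longest J = arg_max (len I) (\<lambda>w. w \<in> wp ` lists J)"
    unfolding longest_elt_def generate_eq_wp[OF J] ..
  show "longest J \<in> wp ` lists J" unfolding eq by (rule arg_max_natI[OF one bound])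
  show "y \<in> wp ` lists J \<Longrightarrow> len I y \<le> len I (longest J)"
    unfolding eq by (rule arg_max_nat_le[OF _ bound])
qed

end

locale finite_simply_laced = simply_laced G I s m
  for G :: "('a, 'b) monoid_scheme" (structure)
    and I :: "'i set" and s :: "'i \<Rightarrow> 'a" and m :: "'i \<Rightarrow> 'i \<Rightarrow> nat" +
  assumes finite_carrier: "finite (carrier G)"
begin

lemma longest_antidominant: "J \<subseteq> I \<Longrightarrow> j \<in> J \<Longrightarrow> gact (longest J) \<rho> j < 0"
  using maximal_antidominant[OF _ longest_maximal(1)[OF finite_carrier] longest_maximal(2)[OF finite_carrier]]
  by simp

lemma longest_in_parabolic: "J \<subseteq> I \<Longrightarrow> longest J \<in> wp ` lists J"
  using longest_maximal(1) finite_carrier by blast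

lemma longest_closed [simp]: "J \<subseteq> I \<Longrightarrow> longest J \<in> carrier G"
  using longest_in_parabolic parabolic_closed by blast

lemma longest_unique:
  assumes "J \<subseteq> I" "x \<in> wp ` lists J" "\<And>j. j \<in> J \<Longrightarrow> gact x \<rho> j \<le> 0"
  shows "x = longest J"
  using parabolic_antidominant_unique[OF assms(1,2) longest_in_parabolic] assms longest_antidominant
  by blast

lemma longest_inv:
  assumes J: "J \<subseteq> I"
  shows "inv (longest J) = longest J"
proof (rule longest_unique[OF J])
  show mem: "inv (longest J) \<in> wp ` lists J"
    by (rule parabolic_inv[OF J longest_in_parabolic[OF J]])
  have "len I y \<le> len I (inv (longest J))" if "y \<in> wp ` lists J" for y
    unfolding len_inv[OF longest_closed[OF J]] by (rule longest_maximal(2)[OF finite_carrier J that])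
  from maximal_antidominant[OF J mem this]
  show "gact (inv (longest J)) \<rho> j \<le> 0" if "j \<in> J" for j
    using that by (simp add: less_imp_le)
qed

lemma longest_empty: "longest {} = \<one>"
  using longest_unique[of "{}" \<one>] by simp

lemma represents_longest:
  assumes "J \<subseteq> I" "u \<in> lists J" "\<And>j. j \<in> J \<Longrightarrow> foldr (dem m) u \<rho> j \<le> 0"
  shows "represents u (longest J)"
proof -
  obtain p where p: "p \<in> lists J" "foldr (dem m) u \<rho> = foldr (reflect m) p \<rho>"
    using dem_eq_act[OF assms(2)] by blast
  have I: "p \<in> lists I" "u \<in> lists I"
    using lists_subset[OF p(1) assms(1)] lists_subset[OF assms(2,1)] by simp_all
  have eq: "foldr (dem m) u \<rho> = gact (wp p) \<rho>" using p I by (simp add: gact_wp)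
  have "wp p = longest J" using longest_unique[OF assms(1), of "wp p"] p assms(3) eq by auto
  then show ?thesis using eq I assms(1) by (simp add: represents_def)
qed

lemma longest_word:
  assumes J: "J \<subseteq> I"
  obtains u where "u \<in> lists J" "represents u (longest J)"
proof -
  obtain u where u: "reduced_word J u" "wp u = longest J"
    using reduced_word_exists[OF longest_in_parabolic[OF J]] .
  have l: "u \<in> lists J" "u \<in> lists I"
    using reduced_word_lists[OF u(1)] lists_subset[OF reduced_word_lists[OF u(1)] J] by simp_all
  have "foldr (dem m) u \<rho> = foldr (reflect m) u \<rho>"
    by (rule dem_reduced[OF J _ u(1)]) (use J in \<open>auto simp: rho_def\<close>)
  then have "represents u (longest J)" using u l J by (simp add: represents_def flip: gact_wp)
  then show ?thesis using that l by blast
qed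

lemma longest_inj:
  assumes "J \<subseteq> I" "K \<subseteq> I" "longest J = longest K"
  shows "J = K"
proof -
  have *: "A \<subseteq> B" if AB: "A \<subseteq> I" "B \<subseteq> I" "longest A = longest B" for A B
  proof
    fix k assume k: "k \<in> A"
    show "k \<in> B"
    proof (rule ccontr)
      assume "k \<notin> B"
      obtain u where "u \<in> lists B" "represents u (longest B)" using longest_word[OF AB(2)] .
      then have "\<rho> k \<le> gact (longest B) \<rho> k" using dem_ge[of u B k \<rho>] \<open>k \<notin> B\<close> 
        by (simp add: represents_def)
      moreover have "gact (longest A) \<rho> k < 0" using longest_antidominant[OF AB(1) k] .
      ultimately show False using AB k by (auto simp: rho_def)
    qed
  qed
  show ?thesis using *[of J K] *[of K J] assms by auto
qed

text \<open>
  The words \<open>j # u\<close> and \<open>u\<close> are congruent because both represent the longest element; therefore they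
  act alike on every weight \<open>v\<close>, also outside of the orbit of \<open>\<rho>\<close>.
\<close>

lemma longest_absorbs_left:
  assumes "J \<subseteq> I" "represents u (longest J)" "j \<in> J"
  shows "foldr (dem m) u v j \<le> 0"
proof -
  have "gact (longest J) \<rho> j < 0" using longest_antidominant[OF assms(1,3)] .
  then have "represents (j # u) (longest J)"
    using assms by (auto simp: represents_def dem_def)
  then have "hecke_equiv I m (j # u) u" by (rule represents_hecke[OF _ assms(2)])
  then have "foldr (dem m) (j # u) v = foldr (dem m) u v" using dem_respects by (simp only:)
  then have "dem m j (foldr (dem m) u v) j = foldr (dem m) u v j" by simp
  then show ?thesis by (auto simp: dem_def reflect_self split: if_splits)
qed

lemma represents_longest_absorbs:
  assumes u: "represents u (longest I)" and pq: "p \<in> lists I" "q \<in> lists I"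
  shows "represents (p @ u @ q) (longest I)"
proof -
  have "u \<in> lists I" using u by (simp add: represents_def)
  moreover have "foldr (dem m) p w = w" if "\<And>i. i \<in> I \<Longrightarrow> w i \<le> 0" for w
    using pq(1) that by (induction p) (auto simp: dem_nonpos)
  ultimately show ?thesis
    using pq longest_absorbs_left[OF subset_refl u] by (intro represents_longest) auto
qed

lemma hecke0_T_eq:
  assumes "represents u g"
  shows "hecke0_T G I s m g = (hecke_word I m u :: ('i list \<Rightarrow> 'k::comm_ring_1) set)"
proof -
  have g: "g \<in> carrier G" using assms by (simp add: represents_def)
  define r where "r = (SOME r. reduced_expression G I s r g)"
  have "\<exists>r. reduced_expression G I s r g"
    using represents_word[OF g] unfolding reduced_expression_def reduced_word_def by blast
  then have "reduced_expression G I s r g" unfolding r_def by (rule someI_ex)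
  then have "reduced_word I r" "wp r = g" by (auto simp: reduced_expression_def reduced_word_def)
  then have "represents r g" using represents_reduced by blast
  then have eq: "hecke_equiv I m r u" using represents_hecke assms by blast
  then have "hecke_word I m r = (hecke_word I m u :: ('i list \<Rightarrow> 'k) set)"
    using hecke_word_eq_iff[of r I u] hecke_equiv_lists[OF eq] by blast
  then show ?thesis by (simp add: hecke0_T_def r_def hecke_word_def)
qed

lemma hecke0_star_eq:
  assumes u: "represents u x" and v: "represents v y" and uv: "represents (u @ v) z"
  shows "hecke0_star TYPE('k::comm_ring_1) G I s m x y = z"
proof -
  have l: "u \<in> lists I" "v \<in> lists I" "z \<in> carrier G" 
    using u v uv by (auto simp: represents_def)
  have prod: "(hecke0_T G I s m x :: ('i list \<Rightarrow> 'k) set) \<otimes>\<^bsub>hecke0_algebra I m\<^esub> hecke0_T G I s m y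
      = hecke_word I m (u @ v)"
    by (simp only: hecke0_T_eq[OF u] hecke0_T_eq[OF v] hecke_word_append[OF l(1,2)])
  show ?thesis
    unfolding hecke0_star_def prod
  proof (rule the_equality)
    show "z \<in> carrier G \<and> (hecke_word I m (u @ v) :: ('i list \<Rightarrow> 'k) set) = hecke0_T G I s m z"
      using l by (simp add: hecke0_T_eq[OF uv])
  next
    fix z' assume z': "z' \<in> carrier G \<and> (hecke_word I m (u @ v) :: ('i list \<Rightarrow> 'k) set) = hecke0_T G I s m z'"
    then obtain t where t: "represents t z'" using represents_word by blast
    then have "(hecke_word I m (u @ v) :: ('i list \<Rightarrow> 'k) set) = hecke_word I m t"
      using z' hecke0_T_eq[OF t, where ?'k='k] by simp
    then have "hecke_equiv I m (u @ v) t"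
      using hecke_word_eq_iff[of "u @ v" I t] l t by (auto simp: represents_def)
    then have "represents t z" using represents_trans uv by blast
    then have "gact z' \<rho> = gact z \<rho>" using t unfolding represents_def by metis
    then show "z' = z" using gact_rho_inj[OF conjunct1[OF z'] l(3)] by (simp only:)
  qed
qed

abbreviation coset_elt :: "'i set \<Rightarrow> 'a" where
  "coset_elt J \<equiv> longest J \<otimes> longest I"

lemma subset_star_eq:
  assumes K: "K \<subseteq> I" and J: "represents u (coset_elt J1)" "represents v (coset_elt J2)" 
    "represents (u @ v) (coset_elt K)"
  shows "subset_star TYPE('k::comm_ring_1) G I s m J1 J2 = K"
  unfolding subset_star_def hecke0_star_eq[OF J]
proof (rule the_equality)
  fix L assume L: "L \<subseteq> I \<and> coset_elt K = coset_elt L"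
  then have "longest K = longest L"
    using right_cancel[of "longest I" "longest K" "longest L"] longest_closed[of L] K by simp
  then show "L = K" using longest_inj L K by blast
qed (use K in simp)

end

text \<open>
  The assumptions hold whenever the longest element acts as \<open>-1\<close> on weights.
\<close>

locale minus_one_type = finite_simply_laced G I s m
  for G :: "('a, 'b) monoid_scheme" (structure)
    and I :: "'i set" and s :: "'i \<Rightarrow> 'a" and m :: "'i \<Rightarrow> 'i \<Rightarrow> nat" +
  assumes longest_rho: "gact (longest I) \<rho> = (\<lambda>k. - \<rho> k)"
    and longest_s: "i \<in> I \<Longrightarrow> s i \<otimes> longest I = longest I \<otimes> s i"
begin

lemma longest_central: 
  assumes "x \<in> carrier G" 
  shows "x \<otimes> longest I = longest I \<otimes> x"
proof -
  have "wp u \<otimes> longest I = longest I \<otimes> wp u" if "u \<in> lists I" for u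
    using that
  proof (induction u)
    case (Cons i u)
    then have "i \<in> I" "u \<in> lists I" by auto
    moreover from this have "s i \<otimes> (longest I \<otimes> wp u) = longest I \<otimes> (s i \<otimes> wp u)"
      using longest_s[of i] by (simp flip: m_assoc)
    ultimately show ?case using Cons.IH by (simp add: m_assoc)
  qed simp
  then show ?thesis using assms carrier_eq_wp by auto
qed

lemma coset_elt_inv: 
  assumes "J \<subseteq> I" 
  shows "inv (coset_elt J) = coset_elt J"
  using assms longest_central[of "longest J"] by (simp add: inv_mult_group longest_inv)

lemma gact_coset_elt:
  assumes "J \<subseteq> I" 
  shows "gact (coset_elt J) \<rho> = (\<lambda>k. - gact (longest J) \<rho> k)"
  using assms by (simp add: gact_mult longest_rho gact_uminus)

text \<open>
  Apply a word for the longest element of \<open>J\<close> to the weight of the longest element of \<open>K\<close>.  The result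
  is the weight of the longest element of \<open>J\<close>, and these steps are reversed on the negated weights,
  which are the weights of \<open>coset_elt J\<close> and \<open>coset_elt K\<close>.
\<close>

lemma coset_elt_extend:
  assumes KJ: "K \<subseteq> J" and J: "J \<subseteq> I" and u: "represents u (coset_elt J)"
  shows "\<exists>q\<in>lists I. represents (q @ u) (coset_elt K)"
proof -
  have K: "K \<subseteq> I" using KJ J by blast
  obtain a where a: "a \<in> lists J" "represents a (longest J)" using longest_word[OF J] .
  let ?v = "gact (longest K) \<rho>"
  obtain p where p: "p \<in> lists J" "foldr (dem m) a ?v = foldr (reflect m) p ?v"
    using dem_eq_act[OF a(1)] by blast
  have pI: "p \<in> lists I" using lists_subset[OF p(1) J] .
  have eq: "foldr (dem m) a ?v = gact (wp p \<otimes> longest K) \<rho>"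
    using p pI K by (simp add: gact_mult gact_wp)
  have "longest K \<in> wp ` lists J" using longest_in_parabolic[OF K] lists_mono[OF KJ] by blast
  then have "wp p \<otimes> longest K \<in> wp ` lists J" using p by (intro parabolic_mult[OF J]) auto
  moreover have "gact (wp p \<otimes> longest K) \<rho> j \<le> 0" if "j \<in> J" for j
    using longest_absorbs_left[OF J a(2) that, of ?v] eq by simp
  ultimately have "wp p \<otimes> longest K = longest J" using longest_unique[OF J] by blast
  then have top: "foldr (dem m) a ?v = gact (longest J) \<rho>" using eq by simp
  obtain q where q: "set q \<subseteq> set a" "foldr (dem m) q (\<lambda>k. - gact (longest J) \<rho> k) = (\<lambda>k. - ?v k)"
    using dem_reverse[of a m ?v] top by auto
  have qI: "q \<in> lists I" using q(1) a(1) J by auto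
  have "represents (q @ u) (coset_elt K)"
    using u qI q(2) K J by (simp add: represents_def gact_coset_elt)
  then show ?thesis using qI by blast
qed

text \<open>
  The product of \<open>coset_elt J1\<close> and \<open>coset_elt J2\<close> in the 0-Hecke monoid is the longest element.
\<close>

definition product_longest :: "'i set \<Rightarrow> 'i set \<Rightarrow> bool" where
  "product_longest J1 J2 \<longleftrightarrow> (\<exists>u v. represents u (coset_elt J1) \<and> represents v (coset_elt J2) \<and>
     represents (u @ v) (longest I))"

text \<open>
  The first factor is extended on the left.  The second one has to be extended on the right; this uses
  reversal, under which the elements \<open>coset_elt J\<close> are stable.
\<close>

lemma product_longest_mono:
  assumes "product_longest J1 J2" "J1 \<subseteq> I" "J2 \<subseteq> I" "K1 \<subseteq> J1" "K2 \<subseteq> J2"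
  shows "product_longest K1 K2"
proof -
  obtain u v where uv: "represents u (coset_elt J1)" "represents v (coset_elt J2)"
     "represents (u @ v) (longest I)" using assms(1) by (auto simp: product_longest_def)
  obtain p where p: "p \<in> lists I" "represents (p @ u) (coset_elt K1)"
    using coset_elt_extend[OF assms(4,2) uv(1)] by blast
  obtain q where q: "q \<in> lists I" "represents (q @ v) (coset_elt K2)"
    using coset_elt_extend[OF assms(5,3) uv(2)] by blast
  have "represents (rev v @ rev q) (coset_elt K2)"
    using represents_rev[OF q(2)] assms coset_elt_inv[of K2] by simp
  moreover have "represents (rev v) (coset_elt J2)"
    using represents_rev[OF uv(2)] assms coset_elt_inv[of J2] by simp
  then have "hecke_equiv I m v (rev v)" using represents_hecke uv by blast
  then have "hecke_equiv I m (u @ v) (u @ rev v)"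
    using uv(1) by (intro hecke_append hecke_refl) (simp_all add: represents_def)
  then have "represents (u @ rev v) (longest I)" using represents_trans uv by blast
  then have "represents (p @ (u @ rev v) @ rev q) (longest I)"
    using p q by (intro represents_longest_absorbs) auto
  then have "represents ((p @ u) @ (rev v @ rev q)) (longest I)" by simp
  ultimately show ?thesis using p(2) unfolding product_longest_def by blast
qed

lemma subset_star_product_longest:
  assumes "product_longest J1 J2"
  shows "subset_star TYPE('k::comm_ring_1) G I s m J1 J2 = {}"
  using assms subset_star_eq[of "{}", where ?'k='k] by (auto simp: product_longest_def longest_empty)

end

section \<open>Weights of type \<open>E\<^sub>8\<close>\<close>

datatype e8_weight = Wt int int int int int int int int

fun e8_coord :: "e8_weight \<Rightarrow> nat \<Rightarrow> int" where
  "e8_coord (Wt a b c d e f g h) i =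
    (if i = 1 then a else if i = 2 then b else if i = 3 then c else if i = 4 then d
     else if i = 5 then e else if i = 6 then f else if i = 7 then g else if i = 8 then h else 0)"

fun e8_reflect :: "nat \<Rightarrow> e8_weight \<Rightarrow> e8_weight" where
  "e8_reflect i (Wt a b c d e f g h) =
    (if i = 1 then Wt (- a) b (c + a) d e f g h
     else if i = 2 then Wt a (- b) c (d + b) e f g h
     else if i = 3 then Wt (a + c) b (- c) (d + c) e f g h
     else if i = 4 then Wt a (b + d) (c + d) (- d) (e + d) f g h
     else if i = 5 then Wt a b c (d + e) (- e) (f + e) g h
     else if i = 6 then Wt a b c d (e + f) (- f) (g + f) h
     else if i = 7 then Wt a b c d e (f + g) (- g) (h + g)
     else Wt a b c d e f (g + h) (- h))"

definition e8_dem :: "nat \<Rightarrow> e8_weight \<Rightarrow> e8_weight" where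
  "e8_dem i v = (if 0 < e8_coord v i then e8_reflect i v else v)"

definition e8_rho :: e8_weight where
  "e8_rho = Wt 1 1 1 1 1 1 1 1"

fun e8_minus :: "e8_weight \<Rightarrow> e8_weight" where
  "e8_minus (Wt a b c d e f g h) = Wt (- a) (- b) (- c) (- d) (- e) (- f) (- g) (- h)"

fun e8_negative :: "e8_weight \<Rightarrow> bool" where
  "e8_negative (Wt a b c d e f g h) \<longleftrightarrow>
    a < 0 \<and> b < 0 \<and> c < 0 \<and> d < 0 \<and> e < 0 \<and> f < 0 \<and> g < 0 \<and> h < 0"

fun e8_descent :: "e8_weight \<Rightarrow> nat option" where
  "e8_descent (Wt a b c d e f g h) =
    (if a < 0 then Some 1 else if b < 0 then Some 2 else if c < 0 then Some 3
     else if d < 0 then Some 4 else if e < 0 then Some 5 else if f < 0 then Some 6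
     else if g < 0 then Some 7 else if h < 0 then Some 8 else None)"

text \<open>
  If \<open>v\<close> is the weight of \<open>x\<close> and \<open>w\<close> that of \<open>y\<close>, the weight of \<open>x * y\<close>: a reduced word of \<open>x\<close> is
  read off by reflecting \<open>v\<close> at negative coordinates until it is dominant, and its letters act on \<open>w\<close>
  by Demazure steps.  The first argument bounds the length of that word; \<open>120\<close> is the number of
  positive roots.
\<close>

fun e8_star :: "nat \<Rightarrow> e8_weight \<Rightarrow> e8_weight \<Rightarrow> e8_weight" where
  "e8_star 0 v w = w"
| "e8_star (Suc n) v w =
    (case e8_descent v of None \<Rightarrow> w | Some i \<Rightarrow> e8_dem i (e8_star n (e8_reflect i v) w))"

text \<open>
  The weight of \<open>coset_elt ({1..8} - {a})\<close>, see \<open>gact_maximal_coset_elt\<close>.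
\<close>

definition e8_coset :: "nat \<Rightarrow> e8_weight" where
  "e8_coset a =
    Wt (if a = 1 then - 22 else 1) (if a = 2 then - 16 else 1) (if a = 3 then - 12 else 1)
       (if a = 4 then - 8 else 1) (if a = 5 then - 10 else 1) (if a = 6 then - 13 else 1)
       (if a = 7 then - 18 else 1) (if a = 8 then - 28 else 1)"

lemma e8_letters: "{1..8::nat} = {1, 2, 3, 4, 5, 6, 7, 8}"
  by auto

lemma e8_letter_cases:
  assumes "i \<in> {1..8::nat}"
  shows "i = 1 \<or> i = 2 \<or> i = 3 \<or> i = 4 \<or> i = 5 \<or> i = 6 \<or> i = 7 \<or> i = 8"
  using assms by auto

lemma reflect_e8_coord:
  assumes "i \<in> {1..8}"
  shows "reflect E8_matrix i (e8_coord v) = e8_coord (e8_reflect i v)"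
proof
  fix k
  show "reflect E8_matrix i (e8_coord v) k = e8_coord (e8_reflect i v) k"
    using e8_letter_cases[OF assms]
    by (elim disjE; cases v)
      (simp_all add: reflect_def cartan_def E8_matrix_def E8_edges_def doubleton_eq_iff)
qed

lemma dem_e8_coord:
  assumes "i \<in> {1..8}"
  shows "dem E8_matrix i (e8_coord v) = e8_coord (e8_dem i v)"
  using reflect_e8_coord[OF assms] by (simp add: dem_def e8_dem_def)

lemma foldr_reflect_e8_coord:
  "set u \<subseteq> {1..8} \<Longrightarrow>
    foldr (reflect E8_matrix) u (e8_coord v) = e8_coord (foldr e8_reflect u v)"
  by (induction u) (simp_all add: reflect_e8_coord)

lemma foldr_dem_e8_coord:
  "set u \<subseteq> {1..8} \<Longrightarrow> foldr (dem E8_matrix) u (e8_coord v) = e8_coord (foldr e8_dem u v)"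
  by (induction u) (simp_all add: dem_e8_coord)

lemma rho_e8_coord: "rho {1..8} = e8_coord e8_rho"
  by (auto simp: rho_def e8_rho_def fun_eq_iff)

lemma e8_coord_minus: "e8_coord (e8_minus v) k = - e8_coord v k"
  by (cases v) simp

lemma e8_coord_negative: "e8_negative v \<Longrightarrow> i \<in> {1..8} \<Longrightarrow> e8_coord v i < 0"
  by (cases v) (auto dest!: e8_letter_cases)

lemma e8_descent_letter: "e8_descent v = Some i \<Longrightarrow> i \<in> {1..8}"
  by (cases v) (auto split: if_splits)

lemma e8_star_word: "\<exists>u. set u \<subseteq> {1..8} \<and> e8_star n v = foldr e8_dem u"
proof (induction n arbitrary: v)
  case 0
  show ?case by (intro exI[of _ "[]"]) (auto simp: fun_eq_iff)
next
  case (Suc n)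
  show ?case
  proof (cases "e8_descent v")
    case None
    then show ?thesis by (intro exI[of _ "[]"]) (auto simp: fun_eq_iff)
  next
    case (Some i)
    obtain u where "set u \<subseteq> {1..8}" "e8_star n (e8_reflect i v) = foldr e8_dem u"
      using Suc.IH by blast
    then show ?thesis
      using Some e8_descent_letter[OF Some] by (intro exI[of _ "i # u"]) (auto simp: fun_eq_iff)
  qed
qed

lemma foldr_replicate: "foldr f (concat (replicate n c)) = foldr f c ^^ n"
  by (induction n) (auto simp: fun_eq_iff)

lemma e8_dem_simps:
  "e8_dem 1 (Wt a b c d e f g h) = (if 0 < a then Wt (- a) b (c + a) d e f g h else Wt a b c d e f g h)"
  "e8_dem 2 (Wt a b c d e f g h) = (if 0 < b then Wt a (- b) c (d + b) e f g h else Wt a b c d e f g h)"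
  "e8_dem 3 (Wt a b c d e f g h) = (if 0 < c then Wt (a + c) b (- c) (d + c) e f g h else Wt a b c d e f g h)"
  "e8_dem 4 (Wt a b c d e f g h) = (if 0 < d then Wt a (b + d) (c + d) (- d) (e + d) f g h else Wt a b c d e f g h)"
  "e8_dem 5 (Wt a b c d e f g h) = (if 0 < e then Wt a b c (d + e) (- e) (f + e) g h else Wt a b c d e f g h)"
  "e8_dem 6 (Wt a b c d e f g h) = (if 0 < f then Wt a b c d (e + f) (- f) (g + f) h else Wt a b c d e f g h)"
  "e8_dem 7 (Wt a b c d e f g h) = (if 0 < g then Wt a b c d e (f + g) (- g) (h + g) else Wt a b c d e f g h)"
  "e8_dem 8 (Wt a b c d e f g h) = (if 0 < h then Wt a b c d e f (g + h) (- h) else Wt a b c d e f g h)"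
  by (simp_all add: e8_dem_def)

lemma e8_star_numeral:
  "e8_star (numeral k) v w = (case e8_descent v of None \<Rightarrow> w
     | Some i \<Rightarrow> e8_dem i (e8_star (pred_numeral k) (e8_reflect i v) w))"
  by (simp add: numeral_eq_Suc)

lemma funpow_numeral:
  "(f ^^ numeral k) x = (f ^^ pred_numeral k) (f x)"
  "(f ^^ 1) x = f x"
  by (simp_all add: numeral_eq_Suc funpow_swap1)

text \<open>
  The computations below are carried out by rewriting.  The letter \<open>1\<close> must not be rewritten to
  \<open>Suc 0\<close>, which would not match the rules for Demazure steps.
\<close>

lemmas e8_compute = e8_dem_simps e8_star_numeral funpow_numeral e8_rho_def e8_coset_def

text \<open>
  The Coxeter number is \<open>30\<close>, and the 15th power of a Coxeter element is the longest element.  That it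
  negates \<open>\<rho>\<close> and the weights of the simple reflections is enough to see that it is central.
\<close>

lemma e8_reflect_rounds:
  "(foldr e8_reflect [1, 2, 3, 4, 5, 6, 7, 8] ^^ 15) e8_rho = e8_minus e8_rho"
  "\<forall>i\<in>{1, 2, 3, 4, 5, 6, 7, 8}. (foldr e8_reflect [1, 2, 3, 4, 5, 6, 7, 8] ^^ 15) (e8_reflect i e8_rho) =
     e8_minus (e8_reflect i e8_rho)"
  by (simp_all add: e8_compute del: One_nat_def)

text \<open>
  Applying the letters of \<open>J\<close> in rounds of Demazure steps eventually reaches the weight of the longest
  element of the parabolic subgroup; nine rounds are enough for all maximal subsets, and further
  rounds do not move that weight.
\<close>

lemma e8_maximal_rounds:
  "\<forall>a\<in>{1, 2, 3, 4, 5, 6, 7, 8}.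
    (foldr e8_dem (filter (\<lambda>i. i \<noteq> a) [1, 2, 3, 4, 5, 6, 7, 8]) ^^ 9) e8_rho = e8_minus (e8_coset a)"
  by (simp add: e8_compute del: One_nat_def)

lemma e8_star_rho:
  "\<forall>a\<in>{1, 2, 3, 4, 5, 6, 7, 8}. e8_star 120 (e8_coset a) e8_rho = e8_coset a"
  by (simp add: e8_compute del: One_nat_def)

text \<open>
  The product in the exceptional case, compared with the weight of the longest element of the parabolic
  subgroup of type \<open>D\<^sub>4\<close> generated by the letters \<open>2, 3, 4, 5\<close>.
\<close>

lemma e8_D4_rounds:
  "(foldr e8_dem [2, 3, 4, 5] ^^ 3) e8_rho = e8_minus (e8_star 120 (e8_coset 8) (e8_coset 8))"
  by (simp add: e8_compute del: One_nat_def)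

lemma e8_D4_sign:
  "\<forall>j\<in>{2, 3, 4, 5}. e8_coord (e8_minus (e8_star 120 (e8_coset 8) (e8_coset 8))) j < 0"
  by (simp add: e8_compute del: One_nat_def)

lemma e8_star_negative:
  "\<forall>a\<in>{1, 2, 3, 4, 5, 6, 7, 8}. \<forall>b\<in>{1, 2, 3, 4, 5, 6, 7, 8}.
    a \<noteq> 8 \<or> b \<noteq> 8 \<longrightarrow> e8_negative (e8_star 120 (e8_coset a) (e8_coset b))"
  by (simp add: e8_compute del: One_nat_def)

text \<open>
  Otherwise the interval \<open>{1..8}\<close>, which is a parameter of the locale below, would be rewritten.
\<close>

declare One_nat_def [simp del]

lemma e8_coord_minus_fun: "e8_coord (e8_minus v) = (\<lambda>k. - e8_coord v k)"
  by (simp add: e8_coord_minus fun_eq_iff)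

locale e8 = finite_simply_laced G "{1..8}" s E8_matrix
  for G :: "('a, 'b) monoid_scheme" (structure) and s :: "nat \<Rightarrow> 'a"
begin

lemma longest_antidominant_weight: "gact (longest {1..8}) \<rho> = (\<lambda>k. - \<rho> k)"
  and longest_commutes: "i \<in> {1..8} \<Longrightarrow> s i \<otimes> longest {1..8} = longest {1..8} \<otimes> s i"
proof -
  define u :: "nat list" where "u = concat (replicate 15 [1, 2, 3, 4, 5, 6, 7, 8])"
  have u: "set u \<subseteq> {1..8}" by (auto simp: u_def)
  then have ul: "u \<in> lists {1..8}" by auto
  have act: "foldr (reflect E8_matrix) u (e8_coord v)
      = e8_coord ((foldr e8_reflect [1, 2, 3, 4, 5, 6, 7, 8] ^^ 15) v)" for v
    unfolding foldr_reflect_e8_coord[OF u] unfolding u_def foldr_replicate ..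
  have rho: "gact (wp u) \<rho> = (\<lambda>k. - \<rho> k)"
    unfolding gact_wp[OF ul] rho_e8_coord act e8_reflect_rounds(1) e8_coord_minus_fun ..
  have w: "wp u = longest {1..8}"
    by (rule longest_unique) (use ul rho in \<open>auto simp: rho_def\<close>)
  show 1: "gact (longest {1..8}) \<rho> = (\<lambda>k. - \<rho> k)" using rho w by simp
  show "s i \<otimes> longest {1..8} = longest {1..8} \<otimes> s i" if i: "i \<in> {1..8}"
  proof (rule gact_rho_inj)
    have "i \<in> {1, 2, 3, 4, 5, 6, 7, 8}" using e8_letter_cases[OF i] by simp
    then have rounds: "(foldr e8_reflect [1, 2, 3, 4, 5, 6, 7, 8] ^^ 15) (e8_reflect i e8_rho)
        = e8_minus (e8_reflect i e8_rho)"
      using e8_reflect_rounds(2) by blast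
    have "gact (longest {1..8}) (reflect E8_matrix i \<rho>) = (\<lambda>k. - reflect E8_matrix i \<rho> k)"
      unfolding w[symmetric] gact_wp[OF ul] rho_e8_coord reflect_e8_coord[OF i] act rounds
        e8_coord_minus_fun ..
    then have "gact (longest {1..8} \<otimes> s i) \<rho> = (\<lambda>k. - reflect E8_matrix i \<rho> k)"
      using i by (simp add: gact_mult gact_s)
    moreover have "gact (s i \<otimes> longest {1..8}) \<rho> = (\<lambda>k. - reflect E8_matrix i \<rho> k)"
      using i by (simp add: gact_s_mult 1 reflect_uminus)
    ultimately show "gact (s i \<otimes> longest {1..8}) \<rho> k = gact (longest {1..8} \<otimes> s i) \<rho> k" for k
      by simp
  qed (use i in auto)
qed

sublocale minus_one_type G "{1..8}" s E8_matrix
  by unfold_locales (use longest_antidominant_weight longest_commutes in auto)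

lemma gact_longest_rounds:
  assumes c: "set c \<subseteq> {1..8}" and v: "(foldr e8_dem c ^^ n) e8_rho = v"
    and neg: "\<And>j. j \<in> set c \<Longrightarrow> e8_coord v j \<le> 0"
  shows "gact (longest (set c)) \<rho> = e8_coord v"
proof -
  have r: "set (concat (replicate n c)) \<subseteq> {1..8}" using c by auto
  have eq: "foldr (dem E8_matrix) (concat (replicate n c)) \<rho> = e8_coord v"
    unfolding rho_e8_coord foldr_dem_e8_coord[OF r] unfolding foldr_replicate v ..
  have "represents (concat (replicate n c)) (longest (set c))"
    by (rule represents_longest[OF c]) (auto simp: eq neg)
  then show ?thesis by (simp add: represents_def eq)
qed

lemma gact_maximal_coset_elt:
  assumes a: "a \<in> {1..8}"
  shows "gact (coset_elt ({1..8} - {a})) \<rho> = e8_coord (e8_coset a)"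
proof -
  let ?c = "filter (\<lambda>i. i \<noteq> a) [1, 2, 3, 4, 5, 6, 7, 8]"
  have c: "set ?c = {1..8} - {a}" unfolding e8_letters by auto
  have "e8_coord (e8_minus (e8_coset a)) j \<le> 0" if "j \<in> {1..8} - {a}" for j
    using that by (auto simp: e8_coset_def dest!: e8_letter_cases)
  moreover have "(foldr e8_dem ?c ^^ 9) e8_rho = e8_minus (e8_coset a)"
    using e8_maximal_rounds e8_letter_cases[OF a] by blast
  ultimately have "gact (longest ({1..8} - {a})) \<rho> = e8_coord (e8_minus (e8_coset a))"
    using gact_longest_rounds[of ?c 9] unfolding c by blast
  then show ?thesis by (simp add: gact_coset_elt e8_coord_minus_fun)
qed

text \<open>
  That \<open>e8_star\<close> maps \<open>\<rho>\<close> back to \<open>e8_coset a\<close> confirms that the word it reads off from \<open>e8_coset a\<close>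
  represents the coset element.
\<close>

lemma represents_maximal_coset_elt:
  assumes a: "a \<in> {1..8}"
  shows "\<exists>u. represents u (coset_elt ({1..8} - {a})) \<and>
    (\<forall>v. foldr (dem E8_matrix) u (e8_coord v) = e8_coord (e8_star 120 (e8_coset a) v))"
proof -
  obtain u where u: "set u \<subseteq> {1..8}" "e8_star 120 (e8_coset a) = foldr e8_dem u"
    using e8_star_word by blast
  have eq: "foldr (dem E8_matrix) u (e8_coord v) = e8_coord (e8_star 120 (e8_coset a) v)" for v
    unfolding foldr_dem_e8_coord[OF u(1)] u(2) ..
  have "e8_star 120 (e8_coset a) e8_rho = e8_coset a"
    using e8_star_rho e8_letter_cases[OF a] by blast
  then have "foldr (dem E8_matrix) u \<rho> = gact (coset_elt ({1..8} - {a})) \<rho>"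
    unfolding gact_maximal_coset_elt[OF a] unfolding rho_e8_coord eq by simp
  moreover have "u \<in> lists {1..8}" using u(1) by auto
  ultimately have "represents u (coset_elt ({1..8} - {a}))" by (simp add: represents_def)
  then show ?thesis using eq by blast
qed

lemma product_longest_maximal:
  assumes a: "a \<in> {1..8}" and b: "b \<in> {1..8}" and ab: "a \<noteq> 8 \<or> b \<noteq> 8"
  shows "product_longest ({1..8} - {a}) ({1..8} - {b})"
proof -
  obtain u where u: "represents u (coset_elt ({1..8} - {a}))"
    "\<forall>v. foldr (dem E8_matrix) u (e8_coord v) = e8_coord (e8_star 120 (e8_coset a) v)"
    using represents_maximal_coset_elt[OF a] by blast
  obtain v where v: "represents v (coset_elt ({1..8} - {b}))"
    using represents_maximal_coset_elt[OF b] by blast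
  have "a \<in> {1, 2, 3, 4, 5, 6, 7, 8}" "b \<in> {1, 2, 3, 4, 5, 6, 7, 8}"
    using e8_letter_cases a b by auto
  then have neg: "e8_negative (e8_star 120 (e8_coset a) (e8_coset b))"
    using e8_star_negative ab by blast
  have "foldr (dem E8_matrix) v \<rho> = e8_coord (e8_coset b)"
    using v gact_maximal_coset_elt[OF b] by (simp add: represents_def)
  then have "foldr (dem E8_matrix) (u @ v) \<rho> = e8_coord (e8_star 120 (e8_coset a) (e8_coset b))"
    by (simp add: u(2))
  moreover have "u @ v \<in> lists {1..8}" using u(1) v by (simp add: represents_def)
  ultimately have "represents (u @ v) (longest {1..8})"
    using e8_coord_negative[OF neg] by (intro represents_longest) (simp_all add: less_imp_le)
  then show ?thesis using u(1) v unfolding product_longest_def by blast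
qed

text \<open>
  Removing the letter \<open>8\<close> leaves the parabolic subgroup of type \<open>E\<^sub>7\<close>.
\<close>

lemma subset_star_E7:
  "subset_star TYPE('k::comm_ring_1) G {1..8} s E8_matrix ({1..8} - {8}) ({1..8} - {8}) = {2, 3, 4, 5}"
proof -
  have 8: "(8::nat) \<in> {1..8}" by simp
  obtain u where u: "represents u (coset_elt ({1..8} - {8}))"
    "\<forall>v. foldr (dem E8_matrix) u (e8_coord v) = e8_coord (e8_star 120 (e8_coset 8) v)"
    using represents_maximal_coset_elt[OF 8] by blast
  let ?w = "e8_star 120 (e8_coset 8) (e8_coset 8)"
  have "foldr (dem E8_matrix) u \<rho> = e8_coord (e8_coset 8)"
    using u(1) gact_maximal_coset_elt[OF 8] by (simp add: represents_def)
  then have uu: "foldr (dem E8_matrix) (u @ u) \<rho> = e8_coord ?w" by (simp add: u(2))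
  have "gact (longest (set [2, 3, 4, 5])) \<rho> = e8_coord (e8_minus ?w)"
    by (rule gact_longest_rounds[OF _ e8_D4_rounds]) (use e8_D4_sign in \<open>auto simp: less_imp_le\<close>)
  then have "gact (coset_elt {2, 3, 4, 5}) \<rho> = e8_coord ?w"
    by (simp add: gact_coset_elt e8_coord_minus_fun)
  then have "represents (u @ u) (coset_elt {2, 3, 4, 5})"
    using u(1) uu by (simp add: represents_def)
  then show ?thesis using u(1) by (intro subset_star_eq) auto
qed

end

theorem mainTheorem7:
  fixes G :: "('a, 'b) monoid_scheme" and s :: "nat \<Rightarrow> 'a" and I J\<^sub>1 J\<^sub>2 :: "nat set"
  assumes "I = {1..8}"
    and "finite_coxeter_group G I s E8_matrix"
    and "J\<^sub>1 \<subset> I" and "J\<^sub>2 \<subset> I"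
  shows "subset_star TYPE('k::comm_ring_1) G I s E8_matrix J\<^sub>1 J\<^sub>2 =
    (if J\<^sub>1 = I - {8} \<and> J\<^sub>2 = I - {8} then {2, 3, 4, 5} else {})"
proof -
  interpret e8 G s
    using assms(1,2)
    by unfold_locales (auto simp: finite_coxeter_group_def E8_matrix_def)
  show ?thesis
  proof (cases "J\<^sub>1 = I - {8} \<and> J\<^sub>2 = I - {8}")
    case True
    then show ?thesis using subset_star_E7 assms(1) by simp
  next
    case False
    have maximal: "\<exists>a\<in>I. J \<subseteq> I - {a} \<and> (a = 8 \<longrightarrow> J = I - {8})" if "J \<subset> I" for J
      using that by blast
    obtain a b where a: "a \<in> I" "J\<^sub>1 \<subseteq> I - {a}" "a = 8 \<longrightarrow> J\<^sub>1 = I - {8}"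
      and b: "b \<in> I" "J\<^sub>2 \<subseteq> I - {b}" "b = 8 \<longrightarrow> J\<^sub>2 = I - {8}"
      using maximal[OF assms(3)] maximal[OF assms(4)] by blast
    have "product_longest (I - {a}) (I - {b})"
      using product_longest_maximal a b False assms(1) by blast
    then have "product_longest J\<^sub>1 J\<^sub>2"
      by (rule product_longest_mono) (use a b assms(1) in auto)
    then have "subset_star TYPE('k) G I s E8_matrix J\<^sub>1 J\<^sub>2 = {}"
      using subset_star_product_longest assms(1) by blast
    then show ?thesis using False by auto
  qed
qed

end
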